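(* There exists a sequence $(f_n)_{n\ge1}$ of epimorphisms $f_n:G_n\twoheadrightarrow G_{n+1}$ such that: \begin{itemize} \item each $G_n$ is a GBS group which is a quotient of $BS(18,36)$ and maps onto $BS(9,18)$; \item for every $n\ge1$ there is no epimorphism $G_{n+1}\twoheadrightarrow G_n$. \end{itemize}
   Context: For nonzero integers $m,n$, $BS(m,n)=\langle a,t\mid ta^mt^{-1}=a^n\rangle$. A generalized Baumslag-Solitar (GBS) group is a finitely generated group acting on a tree (without inversions) with all vertex and edge stabilizers infinite cyclic. *)

theory Defs
  imports "HOL-Algebra.Elementary_Groups" "HOL-Algebra.Group_Action" "Graph_Theory.Digraph_Component"
begin

section \<open>Group presentations and Baumslag--Solitar groups\<close>

text \<open>
  A letter \<open>(x, True)\<close> stands for the generator \<open>x\<close> and \<open>(x, False)\<close> for its formal inverse.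
  All elements of the type \<open>'g\<close> are generators. A relation \<open>u = v\<close> is given as the pair \<open>(u, v)\<close>.
\<close>

type_synonym 'g gword = "('g \<times> bool) list"

inductive_set pres_cong :: "('g gword \<times> 'g gword) set \<Rightarrow> ('g gword \<times> 'g gword) set"
  for R :: "('g gword \<times> 'g gword) set" where
  rel: "(r, s) \<in> R \<Longrightarrow> (u @ r @ v, u @ s @ v) \<in> pres_cong R"
| cancel: "(u @ [(x, b), (x, \<not> b)] @ v, u @ v) \<in> pres_cong R"
| refl: "(u, u) \<in> pres_cong R"
| sym: "(u, v) \<in> pres_cong R \<Longrightarrow> (v, u) \<in> pres_cong R"
| trans: "(u, v) \<in> pres_cong R \<Longrightarrow> (v, w) \<in> pres_cong R \<Longrightarrow> (u, w) \<in> pres_cong R"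

definition presented_group :: "('g gword \<times> 'g gword) set \<Rightarrow> 'g gword set monoid" where
  "presented_group R =
     \<lparr>carrier = UNIV // pres_cong R,
      monoid.mult = (\<lambda>U V. \<Union>u\<in>U. \<Union>v\<in>V. pres_cong R `` {u @ v}),
      one = pres_cong R `` {[]}\<rparr>"

definition gen_pow :: "'g \<Rightarrow> int \<Rightarrow> 'g gword" where
  "gen_pow x k = replicate (nat \<bar>k\<bar>) (x, 0 \<le> k)"

datatype bs_gen = gen_a | gen_t

definition BS :: "int \<Rightarrow> int \<Rightarrow> bs_gen gword set monoid" where
  "BS m n = presented_group
     {(gen_pow gen_t 1 @ gen_pow gen_a m @ gen_pow gen_t (- 1), gen_pow gen_a n)}"

lemma equiv_pres_cong: "equiv UNIV (pres_cong R)"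
  by (intro equivI refl_onI symI transI) (auto intro: pres_cong.intros)

lemma pres_cong_left: "(u, v) \<in> pres_cong R \<Longrightarrow> (w @ u, w @ v) \<in> pres_cong R"
proof (induction rule: pres_cong.induct)
  case (rel r s u v)
  then show ?case using pres_cong.rel[of r s R "w @ u" v] by simp
next
  case (cancel u x b v)
  then show ?case using pres_cong.cancel[of "w @ u" x b v R] by simp
qed (auto intro: pres_cong.intros)

lemma pres_cong_right: "(u, v) \<in> pres_cong R \<Longrightarrow> (u @ w, v @ w) \<in> pres_cong R"
proof (induction rule: pres_cong.induct)
  case (rel r s u v)
  then show ?case using pres_cong.rel[of r s R u "v @ w"] by simp
next
  case (cancel u x b v)
  then show ?case using pres_cong.cancel[of u x b "v @ w" R] by simp
qed (auto intro: pres_cong.intros)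

lemma pres_cong_append:
  "(u, u') \<in> pres_cong R \<Longrightarrow> (v, v') \<in> pres_cong R \<Longrightarrow> (u @ v, u' @ v') \<in> pres_cong R"
  by (meson pres_cong.trans pres_cong_left pres_cong_right)

lemma presented_group_mult:
  "pres_cong R `` {u} \<otimes>\<^bsub>presented_group R\<^esub> pres_cong R `` {v} = pres_cong R `` {u @ v}"
proof -
  have "congruent2 (pres_cong R) (pres_cong R) (\<lambda>x y. pres_cong R `` {x @ y})"
    by (intro congruent2I') (auto intro!: equiv_class_eq[OF equiv_pres_cong] pres_cong_append)
  then show ?thesis
    by (simp add: presented_group_def UN_equiv_class2[OF equiv_pres_cong equiv_pres_cong])
qed

definition word_inv :: "'g gword \<Rightarrow> 'g gword" where
  "word_inv w = rev (map (\<lambda>(x, b). (x, \<not> b)) w)"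

lemma word_inv_cancel: "(word_inv w @ w, []) \<in> pres_cong R"
proof (induction w)
  case Nil
  then show ?case by (simp add: word_inv_def pres_cong.refl)
next
  case (Cons l w)
  obtain x b where l: "l = (x, b)" by fastforce
  have "(word_inv w @ [(x, \<not> b), (x, \<not> \<not> b)] @ w, word_inv w @ w) \<in> pres_cong R"
    by (rule pres_cong.cancel)
  with Cons show ?case
    by (auto simp: word_inv_def l intro: pres_cong.trans)
qed

lemma group_presented_group: "group (presented_group R)"
proof (rule groupI)
  have mem: "x \<in> carrier (presented_group R) \<longleftrightarrow> (\<exists>u. x = pres_cong R `` {u})" for x
    by (auto simp: presented_group_def quotient_def)
  have one: "\<one>\<^bsub>presented_group R\<^esub> = pres_cong R `` {[]}"
    by (simp add: presented_group_def)
  show "\<one>\<^bsub>presented_group R\<^esub> \<in> carrier (presented_group R)"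
    using mem one by blast
  fix x assume "x \<in> carrier (presented_group R)"
  then obtain u where u: "x = pres_cong R `` {u}" using mem by blast
  show "\<one>\<^bsub>presented_group R\<^esub> \<otimes>\<^bsub>presented_group R\<^esub> x = x"
    by (simp add: u one presented_group_mult)
  have "pres_cong R `` {word_inv u} \<otimes>\<^bsub>presented_group R\<^esub> x = \<one>\<^bsub>presented_group R\<^esub>"
    by (simp add: u one presented_group_mult equiv_class_eq[OF equiv_pres_cong word_inv_cancel])
  then show "\<exists>y\<in>carrier (presented_group R). y \<otimes>\<^bsub>presented_group R\<^esub> x = \<one>\<^bsub>presented_group R\<^esub>"
    using mem by blast
  fix y assume "y \<in> carrier (presented_group R)"
  then obtain v where v: "y = pres_cong R `` {v}" using mem by blast
  show "x \<otimes>\<^bsub>presented_group R\<^esub> y \<in> carrier (presented_group R)"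
    using mem presented_group_mult u v by blast
  fix z assume "z \<in> carrier (presented_group R)"
  then obtain w where w: "z = pres_cong R `` {w}" using mem by blast
  show "x \<otimes>\<^bsub>presented_group R\<^esub> y \<otimes>\<^bsub>presented_group R\<^esub> z =
        x \<otimes>\<^bsub>presented_group R\<^esub> (y \<otimes>\<^bsub>presented_group R\<^esub> z)"
    by (simp add: u v w presented_group_mult)
qed

lemma group_BS: "group (BS m n)"
  by (simp add: BS_def group_presented_group)


section \<open>Trees and generalized Baumslag--Solitar groups\<close>

text \<open>
  A \<open>pair_bidirected_digraph\<close> is a simple graph, possibly infinite: each edge is represented by
  its two orientations, so that an edge followed by its reverse is a \<open>cycle\<close> of length 2.
  The constant \<open>tree\<close> of the graph library is not applicable: it excludes directed
  cycles only.
\<close>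

definition simple_tree :: "'v pair_pre_digraph \<Rightarrow> bool" where
  "simple_tree T \<longleftrightarrow>
     pair_bidirected_digraph T \<and>
     connected (with_proj T) \<and>
     \<not> (\<exists>p. pre_digraph.cycle (with_proj T) p \<and> 3 \<le> length p)"

definition infinite_cyclic :: "('a, 'b) monoid_scheme \<Rightarrow> bool" where
  "infinite_cyclic G \<longleftrightarrow> cyclic_group G \<and> infinite (carrier G)"

definition finitely_generated :: "('a, 'b) monoid_scheme \<Rightarrow> bool" where
  "finitely_generated G \<longleftrightarrow>
     (\<exists>S. finite S \<and> S \<subseteq> carrier G \<and> generate G S = carrier G)"

locale tree_action = group_action G "pverts T" \<phi>
  for G (structure) and T :: "'v pair_pre_digraph" and \<phi> +
  assumes tree: "simple_tree T"
    and edge_preserving: "\<lbrakk>g \<in> carrier G; (u, v) \<in> parcs T\<rbrakk> \<Longrightarrow> (\<phi> g u, \<phi> g v) \<in> parcs T"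
    and no_inversion: "\<lbrakk>g \<in> carrier G; (u, v) \<in> parcs T\<rbrakk> \<Longrightarrow> \<not> (\<phi> g u = v \<and> \<phi> g v = u)"

text \<open>
  In the absence of inversions the stabilizer of an edge fixes both of its ends.
\<close>

locale GBS_action = tree_action +
  assumes vertex_stabilizer:
      "v \<in> pverts T \<Longrightarrow> infinite_cyclic (G\<lparr>carrier := stabilizer G \<phi> v\<rparr>)"
    and edge_stabilizer:
      "(u, v) \<in> parcs T \<Longrightarrow>
         infinite_cyclic (G\<lparr>carrier := stabilizer G \<phi> u \<inter> stabilizer G \<phi> v\<rparr>)"

text \<open>
  Taking the vertices in \<open>nat\<close> is no restriction: a finitely generated group is countable, so
  the subtree spanned by the orbit of a vertex is a countable invariant subtree.
\<close>

definition GBS_group :: "('a, 'b) monoid_scheme \<Rightarrow> bool" where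
  "GBS_group G \<longleftrightarrow>
     finitely_generated G \<and> (\<exists>(T :: nat pair_pre_digraph) \<phi>. GBS_action G T \<phi>)"

definition is_quotient_of :: "('a, 'c) monoid_scheme \<Rightarrow> ('b, 'd) monoid_scheme \<Rightarrow> bool" where
  "is_quotient_of Q G \<longleftrightarrow> (\<exists>N. N \<lhd> G \<and> Q \<cong> (G Mod N))"

end

theory Submission
  imports Defs "HOL-Library.Countable_Set"
begin

text \<open>
  The groups are \<open>L\<^sub>n = \<langle>a, b, t | a\<^sup>2 = b\<^bsup>2^n\<^esup>, t b\<^sup>9 t\<^sup>-\<^sup>1 = b\<^sup>1\<^sup>8\<rangle>\<close>: the fundamental group of a
  graph of infinite cyclic groups shaped like a lollipop, with an edge from \<open>\<langle>a\<rangle>\<close> to \<open>\<langle>b\<rangle>\<close>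
  (indices \<open>2\<close> and \<open>2^n\<close>) and a loop at \<open>\<langle>b\<rangle>\<close> (indices \<open>9\<close> and \<open>18\<close>).

  The positive statements are computations with generators. Conjugating by \<open>t\<^sup>-\<^sup>1\<close> halves the
  exponents of powers of \<open>b\<close> divisible by \<open>18\<close>, so the subgroup generated by \<open>a\<close> and \<open>t\<close>, which
  contains \<open>b\<^bsup>9 \<cdot> 2^n\<^esup>\<close>, contains \<open>b\<^sup>9\<close>; with \<open>b\<^bsup>2^n\<^esup>\<close> it contains \<open>b\<close>
  (\<open>generated_by_a_t\<close>). As \<open>t a\<^sup>1\<^sup>8 t\<^sup>-\<^sup>1 = a\<^sup>3\<^sup>6\<close>, the group \<open>L\<^sub>n\<close> is a quotient of \<open>BS(18,36)\<close>. The map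
  \<open>a \<mapsto> a, b \<mapsto> b\<^sup>2, t \<mapsto> t\<close> is an epimorphism \<open>L\<^sub>n \<rightarrow> L\<^sub>n\<^sub>+\<^sub>1\<close>, and sending \<open>b\<close> to the elliptic
  generator of \<open>BS(9,18)\<close> and \<open>a\<close> to its power with exponent \<open>2^(n-1)\<close> maps \<open>L\<^sub>n\<close> onto
  \<open>BS(9,18)\<close>.

  An epimorphism \<open>L\<^sub>n\<^sub>+\<^sub>1 \<rightarrow> L\<^sub>n\<close> would give generators \<open>a', b', t'\<close> of \<open>L\<^sub>n\<close> that satisfy the
  relations of \<open>L\<^sub>n\<^sub>+\<^sub>1\<close> (\<open>no_generators_of_next_level\<close>). Since \<open>b'\<^sup>9\<close> and \<open>b'\<^sup>1\<^sup>8\<close> are conjugate, \<open>b'\<close>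
  has translation length zero in the Bass--Serre tree, and so does \<open>a'\<close>: each of them is
  conjugate to a power of \<open>a\<close> or of \<open>b\<close>. The character \<open>a \<mapsto> 1, b \<mapsto> 0, t \<mapsto> 0\<close> modulo \<open>2\<close> shows
  that \<open>b'\<close> is conjugate to some \<open>b\<^sup>y\<close>; it cannot vanish on \<open>a'\<close> too, because then \<open>t'\<close> alone would
  generate the image of \<open>L\<^sub>n\<close> in \<open>\<int> \<times> \<int>/2\<close>, which is not cyclic. So \<open>a'\<close> is conjugate to some \<open>a\<^sup>x\<close>
  with \<open>x\<close> odd. Now \<open>a'\<^sup>2 = b'\<^bsup>2^(n+1)\<^esup>\<close> says that \<open>b\<close> to the power \<open>2^n x\<close> is conjugate to \<open>b\<close> to
  the power \<open>2^(n+1) y\<close>, and these exponents differ. Distinct powers of \<open>b\<close> are conjugate only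
  through the loop, which needs both exponents to be divisible by \<open>9\<close>
  (\<open>conjugate_b_pow_eq_b_pow\<close>). Hence \<open>3\<close> divides \<open>x\<close> and \<open>y\<close>, both \<open>a'\<close> and \<open>b'\<close> vanish under the
  character to \<open>\<int>/3\<close> with \<open>b \<mapsto> 1, t \<mapsto> 0\<close>, and again \<open>t'\<close> alone would generate a noncyclic
  image.

  The geometric input comes from normal forms: words act on reduced sequences by right
  multiplication, which makes the length of a reduced sequence an invariant of the element that
  it represents (\<open>len_reduced\<close>). The same length orders the neighbours in the coset graph of \<open>\<langle>a\<rangle>\<close>
  and \<open>\<langle>b\<rangle>\<close>, where each vertex has at most one neighbour closer to the root; so this graph is
  a tree, and its stabilizers are infinite cyclic (\<open>GBS_group_lollipop\<close>).
\<close>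

section \<open>Presentations and their universal property\<close>

definition word_value :: "('b, 'c) monoid_scheme \<Rightarrow> ('g \<Rightarrow> 'b) \<Rightarrow> 'g gword \<Rightarrow> 'b" where
  "word_value H f w =
     foldr (\<lambda>(x, s) y. (if s then f x else inv\<^bsub>H\<^esub> f x) \<otimes>\<^bsub>H\<^esub> y) w \<one>\<^bsub>H\<^esub>"

definition pres_gen :: "('g gword \<times> 'g gword) set \<Rightarrow> 'g \<Rightarrow> 'g gword set" where
  "pres_gen R x = pres_cong R `` {[(x, True)]}"

lemma word_value_Nil [simp]: "word_value H f [] = \<one>\<^bsub>H\<^esub>"
  by (simp add: word_value_def)

lemma word_value_Cons:
  "word_value H f ((x, s) # w) = (if s then f x else inv\<^bsub>H\<^esub> f x) \<otimes>\<^bsub>H\<^esub> word_value H f w"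
  by (simp add: word_value_def)

context group
begin

lemma word_value_closed:
  "(\<And>x. f x \<in> carrier G) \<Longrightarrow> word_value G f w \<in> carrier G"
  by (induction w) (auto simp: word_value_Cons)

lemma word_value_append:
  assumes "\<And>x. f x \<in> carrier G"
  shows "word_value G f (u @ v) = word_value G f u \<otimes> word_value G f v"
  by (induction u) (auto simp: word_value_Cons m_assoc assms word_value_closed)

lemma word_value_gen_pow:
  assumes "\<And>x. f x \<in> carrier G"
  shows "word_value G f (gen_pow x k) = f x [^] k"
proof -
  have *: "word_value G f (replicate m (x, s)) = (if s then f x else inv f x) [^] m" for m s
  proof (induction m)
    case (Suc m)
    then show ?case
      using assms nat_pow_Suc2[of "if s then f x else inv f x" m]
      by (auto simp: word_value_Cons)
  qed simp
  show ?thesis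
    using assms * by (auto simp: gen_pow_def int_pow_def2 nat_pow_inv simp del: pow_nat)
qed

lemma word_value_pres_cong:
  assumes f: "\<And>x. f x \<in> carrier G"
    and R: "\<And>r s. (r, s) \<in> R \<Longrightarrow> word_value G f r = word_value G f s"
    and "(u, v) \<in> pres_cong R"
  shows "word_value G f u = word_value G f v"
  using assms(3)
proof induction
  case (cancel u x b v)
  have "word_value G f [(x, b), (x, \<not> b)] = \<one>"
    using f by (simp add: word_value_Cons)
  moreover have "word_value G f (u @ [(x, b), (x, \<not> b)] @ v)
      = word_value G f u \<otimes> (word_value G f [(x, b), (x, \<not> b)] \<otimes> word_value G f v)"
    by (simp only: word_value_append[OF f])
  ultimately show ?case
    using f by (simp add: word_value_append word_value_closed)
qed (auto simp: word_value_append f R)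

text \<open>
  The universal property of a presentation; all homomorphisms out of \<open>BS m n\<close> and out of the
  groups \<open>L\<^sub>n\<close> come from it.
\<close>

lemma presented_group_hom:
  assumes f: "\<And>x. f x \<in> carrier G"
    and R: "\<And>r s. (r, s) \<in> R \<Longrightarrow> word_value G f r = word_value G f s"
  shows "\<exists>h \<in> hom (presented_group R) G. \<forall>x. h (pres_gen R x) = f x"
proof (intro bexI allI)
  define h where "h U = word_value G f (SOME u. u \<in> U)" for U
  have hcl: "h (pres_cong R `` {w}) = word_value G f w" for w
  proof -
    have "w \<in> pres_cong R `` {w}" by (simp add: pres_cong.refl)
    then have "(SOME u. u \<in> pres_cong R `` {w}) \<in> pres_cong R `` {w}" by (rule someI)
    then show ?thesis
      unfolding h_def using word_value_pres_cong[OF f R] by (metis Image_singleton_iff)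
  qed
  show "h \<in> hom (presented_group R) G"
  proof (rule homI)
    fix x assume "x \<in> carrier (presented_group R)"
    then obtain u where u: "x = pres_cong R `` {u}"
      by (auto simp: presented_group_def quotient_def)
    then show "h x \<in> carrier G" by (simp add: hcl word_value_closed f)
    fix y assume "y \<in> carrier (presented_group R)"
    then obtain v where v: "y = pres_cong R `` {v}"
      by (auto simp: presented_group_def quotient_def)
    show "h (x \<otimes>\<^bsub>presented_group R\<^esub> y) = h x \<otimes> h y"
      by (simp add: u v presented_group_mult hcl word_value_append f)
  qed
  show "h (pres_gen R x) = f x" for x
    using f by (simp add: pres_gen_def hcl word_value_Cons)
qed

end

lemma pres_class_closed: "pres_cong R `` {w} \<in> carrier (presented_group R)"
  by (auto simp: presented_group_def quotient_def)

lemma pres_gen_closed: "pres_gen R x \<in> carrier (presented_group R)"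
  by (simp add: pres_gen_def pres_class_closed)

lemma pres_gen_inv:
  "inv\<^bsub>presented_group R\<^esub> pres_gen R x = pres_cong R `` {[(x, False)]}"
proof -
  interpret P: group "presented_group R" by (rule group_presented_group)
  have "([(x, False), (x, True)], []) \<in> pres_cong R"
    using pres_cong.cancel[of "[]" x False "[]" R] by simp
  then have "pres_cong R `` {[(x, False)]} \<otimes>\<^bsub>presented_group R\<^esub> pres_gen R x
      = \<one>\<^bsub>presented_group R\<^esub>"
    unfolding pres_gen_def presented_group_mult
    by (simp add: presented_group_def equiv_class_eq[OF equiv_pres_cong])
  then show ?thesis
    by (rule P.inv_equality) (auto simp: pres_gen_closed pres_class_closed)
qed

lemma pres_class_word_value:
  "pres_cong R `` {w} = word_value (presented_group R) (pres_gen R) w"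
proof (induction w)
  case Nil
  then show ?case by (simp add: presented_group_def)
next
  case (Cons l w)
  obtain x s where l: "l = (x, s)" by fastforce
  have "pres_cong R `` {l # w}
      = pres_cong R `` {[(x, s)]} \<otimes>\<^bsub>presented_group R\<^esub> pres_cong R `` {w}"
    by (simp add: presented_group_mult l)
  then show ?case
    by (cases s) (simp_all add: Cons l word_value_Cons pres_gen_inv[symmetric] pres_gen_def)
qed

lemma presented_group_rel:
  assumes "(r, s) \<in> R"
  shows "word_value (presented_group R) (pres_gen R) r
    = word_value (presented_group R) (pres_gen R) s"
proof -
  have "(r, s) \<in> pres_cong R"
    using pres_cong.rel[OF assms, of "[]" "[]"] by simp
  then show ?thesis
    by (simp add: pres_class_word_value[symmetric] equiv_class_eq[OF equiv_pres_cong])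
qed

lemma presented_group_generate:
  "carrier (presented_group R) = generate (presented_group R) (range (pres_gen R))"
proof -
  interpret P: group "presented_group R" by (rule group_presented_group)
  have "word_value (presented_group R) (pres_gen R) w
      \<in> generate (presented_group R) (range (pres_gen R))" for w
    by (induction w)
      (auto simp: word_value_Cons generate.one
        intro!: generate.eng[OF generate.incl[OF rangeI]] generate.eng[OF generate.inv[OF rangeI]])
  then have "pres_cong R `` {w} \<in> generate (presented_group R) (range (pres_gen R))" for w
    by (simp only: pres_class_word_value)
  moreover have "\<exists>w. x = pres_cong R `` {w}" if "x \<in> carrier (presented_group R)" for x
    using that by (auto simp: presented_group_def quotient_def)
  ultimately have "carrier (presented_group R) \<subseteq> generate (presented_group R) (range (pres_gen R))"
    by (metis subsetI)
  moreover have "range (pres_gen R) \<subseteq> carrier (presented_group R)"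
    using pres_gen_closed by auto
  ultimately show ?thesis
    using P.generate_incl by (intro equalityI)
qed

text \<open>
  Congruent words act alike on any set on which the letters act compatibly with the relations.
  \<open>fold\<close> reads a word from left to right, so this is a right action. The restriction to an
  invariant set \<open>S\<close> is there because inverse letters will cancel only on normal forms.
\<close>

lemma fold_pres_cong:
  assumes closed: "\<And>l s. s \<in> S \<Longrightarrow> act l s \<in> S"
    and cancel: "\<And>x b s. s \<in> S \<Longrightarrow> act (x, \<not> b) (act (x, b) s) = s"
    and rel: "\<And>r r' s. (r, r') \<in> R \<Longrightarrow> s \<in> S \<Longrightarrow> fold act r s = fold act r' s"
    and "(u, v) \<in> pres_cong R" "s \<in> S"
  shows "fold act u s = fold act v s"
proof -
  have cl: "fold act w s \<in> S" if "s \<in> S" for w s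
    using that by (induction w arbitrary: s) (auto simp: closed)
  from assms(4,5) show ?thesis
    by (induction arbitrary: s) (auto simp: cl rel cancel)
qed

section \<open>Generating sets and epimorphisms\<close>

text \<open>
  In \<open>generate.induct\<close> products are built from two arbitrary factors; here a word grows at its
  right end by one generator at a time, as the right action on normal forms requires.
\<close>

lemma (in group) generate_right_induct [consumes 2, case_names one mult inv]:
  assumes "g \<in> generate G S" "S \<subseteq> carrier G"
    and "P \<one>"
    and m: "\<And>g x. g \<in> carrier G \<Longrightarrow> x \<in> S \<Longrightarrow> P g \<Longrightarrow> P (g \<otimes> x)"
    and i: "\<And>g x. g \<in> carrier G \<Longrightarrow> x \<in> S \<Longrightarrow> P g \<Longrightarrow> P (g \<otimes> inv x)"
  shows "P g"
proof -
  have "\<forall>h \<in> carrier G. P h \<longrightarrow> P (h \<otimes> g)"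
    using assms(1)
  proof induction
    case (eng g1 g2)
    then have "g1 \<in> carrier G" "g2 \<in> carrier G"
      using generate_in_carrier[OF assms(2)] by auto
    with eng show ?case by (metis m_assoc m_closed)
  qed (use assms in auto)
  moreover have "g \<in> carrier G" using generate_in_carrier assms by blast
  ultimately show ?thesis using \<open>P \<one>\<close> by force
qed

lemma epi_if_generators_in_image:
  assumes "group G" "group H" "h \<in> hom G H" "carrier H = generate H S" "S \<subseteq> h ` carrier G"
  shows "h \<in> epi G H"
proof -
  interpret h: group_hom G H h
    using assms by (simp add: group_hom_def group_hom_axioms_def)
  have "generate H S \<subseteq> h ` carrier G"
    by (rule h.H.generate_subgroup_incl[OF assms(5) h.img_is_subgroup])
  then show ?thesis
    using assms(3,4) by (auto simp: epi_def)
qed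

lemma epi_imp_is_quotient_of:
  assumes "group G" "group H" "h \<in> epi G H"
  shows "is_quotient_of H G"
proof -
  interpret h: group_hom G H h
    using assms by (simp add: group_hom_def group_hom_axioms_def epi_def)
  have "G Mod (kernel G H h) \<cong> H"
    using h.FactGroup_iso assms(3) by (simp add: epi_def)
  then have "H \<cong> G Mod (kernel G H h)"
    by (rule group.iso_sym[OF normal.factorgroup_is_group[OF h.normal_kernel]])
  then show ?thesis
    unfolding is_quotient_of_def using h.normal_kernel by blast
qed

section \<open>Normal forms for lollipop groups\<close>

text \<open>
  The letters that change the coset of \<open>\<langle>b\<rangle>\<close>: \<open>Up\<close> is \<open>t\<close>, \<open>Down\<close> is \<open>t\<^sup>-\<^sup>1\<close> and \<open>Flip\<close> is \<open>a\<close>. Treating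
  \<open>a\<close> as a stable letter whose square is a power of \<open>b\<close> puts the amalgam and the HNN
  extension on the same footing, so that normal forms need cosets of \<open>\<langle>b\<rangle>\<close> only.
\<close>

datatype edge = Up | Down | Flip

fun opp :: "edge \<Rightarrow> edge" where
  "opp Up = Down" | "opp Down = Up" | "opp Flip = Flip"

text \<open>
  The indices describe how powers of \<open>b\<close> pass a letter:
  \<open>b\<close> to the power \<open>idx n x\<close>, followed by \<open>x\<close>, equals \<open>x\<close> followed by \<open>b\<close> to the power
  \<open>idx n (opp x)\<close>.
\<close>

fun idx :: "nat \<Rightarrow> edge \<Rightarrow> int" where
  "idx n Up = 18" | "idx n Down = 9" | "idx n Flip = 2 ^ n"

text \<open>
  The product of \<open>x\<close> and \<open>opp x\<close> is \<open>b\<close> to the power \<open>turn n x\<close>.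
\<close>

fun turn :: "nat \<Rightarrow> edge \<Rightarrow> int" where
  "turn n Flip = 2 ^ n" | "turn n Up = 0" | "turn n Down = 0"

text \<open>
  The state \<open>([(r\<^sub>k, x\<^sub>k), \<dots>, (r\<^sub>1, x\<^sub>1)], m)\<close> stands for the product
  \<open>b\<^bsup>r1\<^esup> x\<^sub>1 \<cdots> b\<^bsup>rk\<^esup> x\<^sub>k b\<^sup>m\<close>. The last letter comes first in the list, because
  right multiplication works at that end.
\<close>

type_synonym state = "(int \<times> edge) list \<times> int"

text \<open>
  A subword \<open>opp x b\<^sup>r x\<close> can be shortened exactly if \<open>b\<^sup>r\<close> passes \<open>x\<close>, that is, if \<open>idx n x\<close>
  divides \<open>r\<close>. The exponents in a reduced list are otherwise arbitrary; in a normal form they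
  are the least nonnegative representatives, which makes it unique.
\<close>

fun reduced :: "nat \<Rightarrow> (int \<times> edge) list \<Rightarrow> bool" where
  "reduced n [] = True"
| "reduced n [_] = True"
| "reduced n ((r, x) # (r', x') # s) \<longleftrightarrow>
     \<not> (x' = opp x \<and> idx n x dvd r) \<and> reduced n ((r', x') # s)"

definition normal_form :: "nat \<Rightarrow> (int \<times> edge) list \<Rightarrow> bool" where
  "normal_form n s \<longleftrightarrow> reduced n s \<and> (\<forall>(r, x) \<in> set s. 0 \<le> r \<and> r < idx n x)"

definition shift :: "int \<Rightarrow> state \<Rightarrow> state" where
  "shift k w = (fst w, snd w + k)"

text \<open>
  Right multiplication of a normal form by the letter \<open>x\<close>: the multiple of \<open>idx n x\<close> in the last
  exponent moves past \<open>x\<close>; then \<open>x\<close> either cancels against a preceding \<open>opp x\<close> or is appended.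
\<close>

definition step :: "nat \<Rightarrow> edge \<Rightarrow> state \<Rightarrow> state" where
  "step n x w =
     (let r = snd w mod idx n x; m = snd w div idx n x * idx n (opp x) in
      if r = 0 \<and> fst w \<noteq> [] \<and> snd (hd (fst w)) = opp x
      then (tl (fst w), fst (hd (fst w)) + turn n x + m)
      else ((r, x) # fst w, m))"

lemma opp_opp [simp]: "opp (opp x) = x" by (cases x) auto
lemma idx_pos [simp]: "0 < idx n x" by (cases x) auto
lemma idx_nonzero [simp]: "idx n x \<noteq> 0" by (cases x) auto
lemma turn_opp [simp]: "turn n (opp x) = turn n x" by (cases x) auto
lemma turn_idx: "turn n x div idx n x * idx n (opp x) = turn n x" by (cases x) auto
lemma idx_dvd_turn: "idx n x dvd turn n x" by (cases x) auto

lemma fst_shift [simp]: "fst (shift k w) = fst w" by (simp add: shift_def)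
lemma shift_shift [simp]: "shift j (shift k w) = shift (k + j) w" by (simp add: shift_def)
lemma shift_0 [simp]: "shift 0 w = w" by (simp add: shift_def)

lemma reduced_tl: "reduced n s \<Longrightarrow> reduced n (tl s)"
  by (induction n s rule: reduced.induct) auto

lemma reduced_Cons:
  "reduced n ((r, x) # s) \<longleftrightarrow>
     \<not> (s \<noteq> [] \<and> snd (hd s) = opp x \<and> idx n x dvd r) \<and> reduced n s"
  by (cases s) auto

lemma normal_form_step: "normal_form n (fst w) \<Longrightarrow> normal_form n (fst (step n x w))"
  by (auto simp: normal_form_def step_def Let_def reduced_tl reduced_Cons dvd_eq_mod_eq_0
      dest: list.set_sel(2) )

lemma step_shift: "step n x (shift (k * idx n x) w) = shift (k * idx n (opp x)) (step n x w)"
  by (auto simp: step_def shift_def Let_def algebra_simps)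

text \<open>
  Together with \<open>step_shift\<close> this contains all relations of \<open>L\<^sub>n\<close>. It needs normal forms: in the
  cancelling case the removed pair \<open>(r, opp x)\<close> must come back unchanged, so \<open>r\<close> must be a
  least representative, and the second step must not cancel once more.
\<close>

lemma step_opp_step:
  assumes "normal_form n (fst w)"
  shows "step n (opp x) (step n x w) = shift (turn n x) w"
proof -
  obtain s m where w: "w = (s, m)" by fastforce
  show ?thesis
  proof (cases "m mod idx n x = 0 \<and> s \<noteq> [] \<and> snd (hd s) = opp x")
    case False
    then have *: "step n x w = ((m mod idx n x, x) # s, m div idx n x * idx n (opp x))"
      by (auto simp: step_def w Let_def)
    show ?thesis
      unfolding * by (simp add: step_def w Let_def shift_def mod_div_mult_eq)
  next
    case True
    then obtain r t where s: "s = (r, opp x) # t"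
      by (metis list.exhaust_sel prod.collapse)
    have r: "0 \<le> r" "r < idx n (opp x)" and nd: "\<not> (t \<noteq> [] \<and> snd (hd t) = x \<and> r = 0)"
      using assms by (auto simp: normal_form_def w s reduced_Cons)
    obtain q where m: "m = q * idx n x" using True by (metis dvd_def mod_0_imp_dvd mult.commute)
    obtain e where e: "turn n x = e * idx n (opp x)"
      by (metis idx_dvd_turn turn_opp dvd_def mult.commute)
    have e': "e * idx n x = turn n x"
      using turn_idx[of n "opp x"] e by simp
    have "step n x w = (t, r + (e + q) * idx n (opp x))"
      using True by (simp add: step_def w s Let_def m e algebra_simps)
    moreover have "(r + (e + q) * idx n (opp x)) mod idx n (opp x) = r"
      "(r + (e + q) * idx n (opp x)) div idx n (opp x) = e + q"
      using r by simp_all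
    ultimately have "step n (opp x) (step n x w) = ((r, opp x) # t, (e + q) * idx n x)"
      using nd by (auto simp: step_def Let_def)
    then show ?thesis
      by (simp add: shift_def w s m distrib_right e' add.commute)
  qed
qed

lemma length_step: "length (fst (step n x w)) = Suc (length (fst w)) \<or>
    Suc (length (fst (step n x w))) = length (fst w)"
  by (cases "fst w") (auto simp: step_def Let_def)

section \<open>Conjugation\<close>

definition (in group) conjugate :: "'a \<Rightarrow> 'a \<Rightarrow> 'a" where
  "conjugate c g = c \<otimes> g \<otimes> inv c"

context group
begin

lemma conjugate_closed [simp]:
  "c \<in> carrier G \<Longrightarrow> g \<in> carrier G \<Longrightarrow> conjugate c g \<in> carrier G"
  by (simp add: conjugate_def)

lemma conjugate_mult:
  assumes "c \<in> carrier G" "g \<in> carrier G" "h \<in> carrier G"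
  shows "conjugate c (g \<otimes> h) = conjugate c g \<otimes> conjugate c h"
  using assms by (simp add: conjugate_def m_assoc inv_solve_left)

lemma conjugate_conjugate:
  assumes "c \<in> carrier G" "d \<in> carrier G" "g \<in> carrier G"
  shows "conjugate c (conjugate d g) = conjugate (c \<otimes> d) g"
  using assms by (simp add: conjugate_def m_assoc inv_mult_group)

lemma conjugate_one [simp]: "g \<in> carrier G \<Longrightarrow> conjugate \<one> g = g"
  by (simp add: conjugate_def)

lemma conjugate_eq_iff:
  assumes "c \<in> carrier G" "g \<in> carrier G" "h \<in> carrier G"
  shows "conjugate c g = h \<longleftrightarrow> c \<otimes> g = h \<otimes> c"
    and "conjugate c g = h \<longleftrightarrow> g = conjugate (inv c) h"
proof -
  show *: "conjugate c g = h \<longleftrightarrow> c \<otimes> g = h \<otimes> c"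
    using assms by (metis conjugate_def inv_solve_right' m_closed)
  have "g = inv c \<otimes> h \<otimes> c \<longleftrightarrow> c \<otimes> g = h \<otimes> c"
    using assms by (metis inv_solve_left m_assoc m_closed inv_closed)
  then show "conjugate c g = h \<longleftrightarrow> g = conjugate (inv c) h"
    using assms * by (simp add: conjugate_def)
qed

lemma conjugate_int_pow:
  assumes "c \<in> carrier G" "g \<in> carrier G"
  shows "conjugate c g [^] (k::int) = conjugate c (g [^] k)"
proof -
  have "conjugate c \<in> hom G G"
    using assms by (auto simp: hom_def conjugate_mult)
  then show ?thesis
    using hom_int_pow[of "conjugate c" G G g k] assms is_group by simp
qed

lemma intertwine_int_pow:
  assumes "c \<in> carrier G" "g \<in> carrier G" "h \<in> carrier G" "g \<otimes> c = c \<otimes> h"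
  shows "g [^] (k::int) \<otimes> c = c \<otimes> h [^] k"
proof -
  have "conjugate c h = g" using assms by (simp add: conjugate_eq_iff)
  then have "conjugate c (h [^] k) = g [^] k"
    using conjugate_int_pow assms by metis
  then show ?thesis using assms by (simp add: conjugate_eq_iff)
qed

end

section \<open>Groups with a faithful normal form\<close>

text \<open>
  The presented group and a copy of it on the natural numbers are both instances, so that the
  tree can be constructed for the copy. The rules for the parameter \<open>nf\<close> say that nothing holds in
  the group beyond the consequences of the two relations.
\<close>

locale lollipop = group G for G (structure) +
  fixes n :: nat and a b t :: 'a and nf :: "'a \<Rightarrow> state"
  assumes gens_closed [simp]: "a \<in> carrier G" "b \<in> carrier G" "t \<in> carrier G"
    and generated: "carrier G = generate G {a, b, t}"
    and rel_a: "a [^] (2::int) = b [^] (2 ^ n :: int)"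
    and rel_t: "t \<otimes> b [^] (9::int) \<otimes> inv t = b [^] (18::int)"
    and nf_one: "nf \<one> = ([], 0)"
    and nf_normal_form: "g \<in> carrier G \<Longrightarrow> normal_form n (fst (nf g))"
    and nf_mult_a: "g \<in> carrier G \<Longrightarrow> nf (g \<otimes> a) = step n Flip (nf g)"
    and nf_mult_b: "g \<in> carrier G \<Longrightarrow> nf (g \<otimes> b) = shift 1 (nf g)"
    and nf_mult_t: "g \<in> carrier G \<Longrightarrow> nf (g \<otimes> t) = step n Up (nf g)"
begin

fun el :: "edge \<Rightarrow> 'a" where
  "el Up = t" | "el Down = inv t" | "el Flip = a"

fun evs :: "(int \<times> edge) list \<Rightarrow> 'a" where
  "evs [] = \<one>"
| "evs ((r, x) # s) = evs s \<otimes> b [^] r \<otimes> el x"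

definition ev :: "state \<Rightarrow> 'a" where
  "ev w = evs (fst w) \<otimes> b [^] snd w"

text \<open>
  In the tree whose vertices are the cosets of \<open>\<langle>b\<rangle>\<close>, with edges given by the letters,
  \<open>len g\<close> is the distance between \<open>\<langle>b\<rangle>\<close> and \<open>g\<langle>b\<rangle>\<close>.
\<close>

definition len :: "'a \<Rightarrow> nat" where
  "len g = length (fst (nf g))"

lemma el_closed [simp]: "el x \<in> carrier G"
  by (cases x) auto

lemma evs_closed [simp]: "evs s \<in> carrier G"
  by (induction s rule: evs.induct) auto

lemma b_pow_add: "b [^] (i::int) \<otimes> b [^] (j::int) = b [^] (i + j)"
  by (simp add: int_pow_mult)

lemma b_pow_assoc: "g \<in> carrier G \<Longrightarrow> g \<otimes> b [^] (i::int) \<otimes> b [^] (j::int) = g \<otimes> b [^] (i + j)"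
  by (simp add: m_assoc b_pow_add)

lemma a_pow_2: "a \<otimes> a = b [^] (2 ^ n :: int)"
proof -
  have "a [^] (2::int) = a \<otimes> a"
    using int_pow_mult[of a 1 1] by simp
  then show ?thesis using rel_a by simp
qed

lemma el_opp: "el x \<otimes> el (opp x) = b [^] turn n x"
  by (cases x) (auto simp: a_pow_2)

lemma el_opp': "el (opp x) \<otimes> el x = b [^] turn n x"
  using el_opp[of "opp x"] by simp

lemma inv_el: "inv (el x) = el (opp x) \<otimes> b [^] (- turn n x)"
proof -
  have "el x \<otimes> (el (opp x) \<otimes> b [^] (- turn n x)) = \<one>"
    by (simp add: m_assoc[symmetric] el_opp b_pow_add)
  then show ?thesis by (intro inv_equality) (auto intro: inv_comm)
qed

lemma b_idx_el: "b [^] (k * idx n x) \<otimes> el x = el x \<otimes> b [^] (k * idx n (opp x))"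
proof -
  have t: "t \<otimes> b [^] (9::int) = b [^] (18::int) \<otimes> t"
    using rel_t by (simp add: inv_solve_right')
  have "b [^] idx n x \<otimes> el x = el x \<otimes> b [^] idx n (opp x)"
  proof (cases x)
    case Down
    have "inv t \<otimes> (b [^] (18::int) \<otimes> t) \<otimes> inv t = inv t \<otimes> (t \<otimes> b [^] (9::int)) \<otimes> inv t"
      by (simp only: t)
    moreover have "inv t \<otimes> (b [^] (18::int) \<otimes> t) \<otimes> inv t = inv t \<otimes> b [^] (18::int)"
      by (simp add: m_assoc)
    moreover have "inv t \<otimes> (t \<otimes> b [^] (9::int)) \<otimes> inv t = b [^] (9::int) \<otimes> inv t"
      by (simp add: m_assoc[symmetric])
    ultimately show ?thesis using Down by simp
  qed (simp_all add: t flip: a_pow_2, simp add: m_assoc)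
  then have "(b [^] idx n x) [^] k \<otimes> el x = el x \<otimes> (b [^] idx n (opp x)) [^] k"
    by (intro intertwine_int_pow) auto
  then show ?thesis by (simp add: int_pow_pow mult.commute)
qed

lemma ev_shift: "ev (shift k w) = ev w \<otimes> b [^] k"
  by (simp add: ev_def shift_def b_pow_assoc)

lemma ev_step: "ev (step n x w) = ev w \<otimes> el x"
proof -
  obtain s m where w: "w = (s, m)" by fastforce
  define q r where "q = m div idx n x" and "r = m mod idx n x"
  have m: "m = r + q * idx n x" by (simp add: q_def r_def mod_div_mult_eq)
  have "b [^] m \<otimes> el x = b [^] r \<otimes> (b [^] (q * idx n x) \<otimes> el x)"
    by (simp add: m m_assoc flip: b_pow_add)
  then have *: "b [^] m \<otimes> el x = b [^] r \<otimes> (el x \<otimes> b [^] (q * idx n (opp x)))"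
    by (simp only: b_idx_el)
  show ?thesis
  proof (cases "r = 0 \<and> s \<noteq> [] \<and> snd (hd s) = opp x")
    case False
    then have "step n x w = ((r, x) # s, q * idx n (opp x))"
      by (auto simp: step_def w Let_def q_def r_def)
    then show ?thesis
      by (simp add: ev_def w * m_assoc)
  next
    case True
    then obtain i u where s: "s = (i, opp x) # u"
      by (metis list.exhaust_sel prod.collapse)
    have "step n x w = (u, i + turn n x + q * idx n (opp x))"
      using True by (simp add: step_def w Let_def q_def r_def s)
    moreover have "ev w \<otimes> el x
        = evs u \<otimes> b [^] i \<otimes> (el (opp x) \<otimes> el x) \<otimes> b [^] (q * idx n (opp x))"
      using True * by (simp add: ev_def w s m_assoc)
    ultimately show ?thesis
      by (simp add: ev_def el_opp' b_pow_assoc)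
  qed
qed

lemma nf_mult_el:
  assumes "g \<in> carrier G"
  shows "nf (g \<otimes> el x) = step n x (nf g)"
proof (cases x)
  case Down
  have "nf g = nf (g \<otimes> inv t \<otimes> t)" using assms by (simp add: m_assoc)
  also have "\<dots> = step n Up (nf (g \<otimes> inv t))" using assms by (simp add: nf_mult_t)
  finally have "step n (opp Up) (nf g) = shift 0 (nf (g \<otimes> inv t))"
    using step_opp_step[of n "nf (g \<otimes> inv t)" Up] nf_normal_form assms by simp
  then show ?thesis using Down by simp
qed (use assms in \<open>simp_all add: nf_mult_a nf_mult_t\<close>)

lemma nf_mult_b_pow:
  assumes "g \<in> carrier G"
  shows "nf (g \<otimes> b [^] (k::int)) = shift k (nf g)"
proof (induction k rule: int_induct[where k = 0])
  case base
  then show ?case using assms by simp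
next
  case (step1 i)
  have "nf (g \<otimes> b [^] (i + 1)) = nf (g \<otimes> b [^] i \<otimes> b)"
    using assms b_pow_add[of i 1] by (simp add: m_assoc)
  then show ?case using assms step1 by (simp add: nf_mult_b)
next
  case (step2 i)
  have "nf (g \<otimes> b [^] i) = nf (g \<otimes> b [^] (i - 1) \<otimes> b)"
    using assms b_pow_add[of "i - 1" 1] by (simp add: m_assoc)
  then have "shift i (nf g) = shift 1 (nf (g \<otimes> b [^] (i - 1)))"
    using assms step2 by (simp add: nf_mult_b)
  then have "shift (-1) (shift i (nf g)) = nf (g \<otimes> b [^] (i - 1))"
    by simp
  then show ?case by simp
qed

lemma inv_a: "inv a = b [^] (- (2 ^ n) :: int) \<otimes> a"
proof -
  have "b [^] (- (2 ^ n) :: int) \<otimes> a \<otimes> a = \<one>"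
    by (simp add: m_assoc a_pow_2 b_pow_add)
  then show ?thesis by (intro inv_equality) auto
qed

text \<open>
  This makes \<open>nf\<close> injective: equality in the group is equality of normal forms.
\<close>

lemma ev_nf:
  assumes "g \<in> carrier G"
  shows "ev (nf g) = g"
proof -
  have "g \<in> generate G {a, b, t}" using assms by (simp only: generated)
  moreover have "{a, b, t} \<subseteq> carrier G" by simp
  ultimately show ?thesis
  proof (induction rule: generate_right_induct)
    case one
    then show ?case by (simp add: nf_one ev_def)
  next
    case (mult g x)
    then show ?case by (auto simp: nf_mult_a nf_mult_b nf_mult_t ev_step ev_shift)
  next
    case (inv g x)
    have "nf (g \<otimes> inv a) = step n Flip (nf (g \<otimes> b [^] (- (2 ^ n) :: int)))"
      using inv by (simp add: inv_a nf_mult_a flip: m_assoc)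
    then have A: "ev (nf (g \<otimes> inv a)) = g \<otimes> inv a"
      using inv by (simp add: nf_mult_b_pow ev_step ev_shift inv_a m_assoc)
    have B: "ev (nf (g \<otimes> inv b)) = g \<otimes> inv b"
      using inv nf_mult_b_pow[of g "-1"] by (simp add: ev_shift int_pow_neg)
    have T: "ev (nf (g \<otimes> inv t)) = g \<otimes> inv t"
      using inv nf_mult_el[of g Down] by (simp add: ev_step)
    show ?case using A B T inv by auto
  qed
qed

lemma decompose:
  assumes "g \<in> carrier G"
  obtains m where "g = evs (fst (nf g)) \<otimes> b [^] (m::int)"
  using ev_nf[OF assms] by (metis ev_def)

lemma len_mult_b_pow [simp]: "g \<in> carrier G \<Longrightarrow> len (g \<otimes> b [^] (k::int)) = len g"
  by (simp add: len_def nf_mult_b_pow)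

lemma len_one [simp]: "len \<one> = 0"
  by (simp add: len_def nf_one)

lemma len_b_pow [simp]: "len (b [^] (k::int)) = 0"
  using len_mult_b_pow[of \<one> k] by simp

lemma len_mult_el:
  "g \<in> carrier G \<Longrightarrow> len (g \<otimes> el x) = Suc (len g) \<or> Suc (len (g \<otimes> el x)) = len g"
  using length_step[of n x "nf g"] by (simp add: len_def nf_mult_el)

lemma len_mult_evs:
  assumes "g \<in> carrier G"
  shows "len (g \<otimes> evs s) \<le> len g + length s"
proof (induction s rule: evs.induct)
  case (2 r x s)
  have "len (g \<otimes> evs ((r, x) # s)) \<le> Suc (len (g \<otimes> evs s \<otimes> b [^] r))"
    using assms len_mult_el[of "g \<otimes> evs s \<otimes> b [^] r" x] by (auto simp: m_assoc)
  then show ?case using 2 assms by simp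
qed (use assms in simp)

lemma len_evs: "len (evs s) \<le> length s"
  using len_mult_evs[of \<one> s] by simp

lemma len_mult:
  assumes "g \<in> carrier G" "h \<in> carrier G"
  shows "len (g \<otimes> h) \<le> len g + len h"
proof -
  obtain m where "h = evs (fst (nf h)) \<otimes> b [^] (m::int)" using decompose assms by blast
  then have "len (g \<otimes> h) = len (g \<otimes> evs (fst (nf h)))"
    using assms by (metis evs_closed int_pow_closed gens_closed(2) len_mult_b_pow m_assoc m_closed)
  then show ?thesis using assms len_mult_evs by (simp add: len_def)
qed

text \<open>
  Inverting a product of letters and powers of \<open>b\<close> gives a product with as many letters. This
  is the way to control left multiplication, on which normal forms give no direct hold.
\<close>

lemma len_inv_le:
  assumes "g \<in> carrier G"
  shows "len (inv g) \<le> len g"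
proof -
  have *: "len (h \<otimes> inv (evs s)) \<le> len h + length s" if "h \<in> carrier G" for h s
    using that
  proof (induction s arbitrary: h rule: evs.induct)
    case (2 r x s)
    define k where "k = h \<otimes> el (opp x) \<otimes> b [^] (- turn n x) \<otimes> b [^] (- r)"
    have k: "k \<in> carrier G" using 2 by (simp add: k_def)
    have "h \<otimes> inv (evs ((r, x) # s)) = k \<otimes> inv (evs s)"
      using 2 by (simp add: k_def inv_mult_group inv_el m_assoc int_pow_neg)
    then have "len (h \<otimes> inv (evs ((r, x) # s))) \<le> len k + length s"
      using 2(1)[OF k] by simp
    moreover have "len k \<le> Suc (len h)"
      using len_mult_el[of h "opp x"] 2 by (auto simp: k_def)
    ultimately show ?case by simp
  qed simp
  obtain m where m: "g = evs (fst (nf g)) \<otimes> b [^] (m::int)" using decompose assms by blast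
  have "inv g = b [^] (-m) \<otimes> inv (evs (fst (nf g)))"
    by (subst m) (simp add: inv_mult_group int_pow_neg)
  then show ?thesis
    using *[of "b [^] (-m)" "fst (nf g)"] by (simp add: len_def[of g])
qed

lemma len_inv [simp]: "g \<in> carrier G \<Longrightarrow> len (inv g) = len g"
  using len_inv_le[of g] len_inv_le[of "inv g"] by simp

lemma len_b_pow_mult [simp]:
  assumes "g \<in> carrier G"
  shows "len (b [^] (k::int) \<otimes> g) = len g"
proof -
  have "len (b [^] k \<otimes> g) = len (inv g \<otimes> b [^] (-k))"
    using assms len_inv[of "b [^] k \<otimes> g"] by (simp add: inv_mult_group int_pow_neg del: len_inv)
  then show ?thesis using assms by simp
qed

lemma len_conjugate:
  assumes "c \<in> carrier G" "g \<in> carrier G"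
  shows "len (conjugate c g) \<le> 2 * len c + len g"
  using assms len_mult[of "c \<otimes> g" "inv c"] len_mult[of c g] by (simp add: conjugate_def)

text \<open>
  Britton's lemma. Evaluating a reduced list letter by letter never cancels: after the letter \<open>x\<close>
  the last exponent is a multiple of \<open>idx n (opp x)\<close>, so adding the next exponent \<open>r\<close> keeps the
  class modulo \<open>idx n (opp x)\<close> that decides about a cancellation with \<open>opp x\<close>.
\<close>

lemma len_reduced:
  assumes "reduced n s"
  shows "len (evs s) = length s"
proof -
  have "length (fst (nf (evs s))) = length s \<and>
     (s \<noteq> [] \<longrightarrow> snd (hd (fst (nf (evs s)))) = snd (hd s) \<and>
       idx n (opp (snd (hd s))) dvd snd (nf (evs s)))"
    using assms
  proof (induction s rule: evs.induct)
    case (2 r x s)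
    define w where "w = nf (evs s)"
    have red: "reduced n s" and nd: "\<not> (s \<noteq> [] \<and> snd (hd s) = opp x \<and> idx n x dvd r)"
      using 2(2) by (auto simp: reduced_Cons)
    have IH: "length (fst w) = length s"
       "s \<noteq> [] \<Longrightarrow> snd (hd (fst w)) = snd (hd s) \<and> idx n (opp (snd (hd s))) dvd snd w"
      using 2(1)[OF red] by (auto simp: w_def)
    have "\<not> ((snd w + r) mod idx n x = 0 \<and> fst w \<noteq> [] \<and> snd (hd (fst w)) = opp x)"
    proof
      assume A: "(snd w + r) mod idx n x = 0 \<and> fst w \<noteq> [] \<and> snd (hd (fst w)) = opp x"
      then have "s \<noteq> []" using IH by auto
      with A IH have "snd (hd s) = opp x" "idx n x dvd snd w" by auto
      with A nd \<open>s \<noteq> []\<close> show False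
        by (metis dvd_add_right_iff dvd_eq_mod_eq_0)
    qed
    then have "step n x (shift r w) =
        (((snd w + r) mod idx n x, x) # fst w, (snd w + r) div idx n x * idx n (opp x))"
      by (auto simp: step_def Let_def shift_def)
    moreover have "nf (evs ((r, x) # s)) = step n x (shift r w)"
      by (simp add: nf_mult_el nf_mult_b_pow w_def)
    ultimately show ?case using IH by simp
  qed (simp add: nf_one)
  then show ?thesis by (simp add: len_def)
qed

end

section \<open>Elliptic elements and powers of \<open>b\<close>\<close>

lemma reduced_append:
  "reduced n (u @ v) \<longleftrightarrow> reduced n u \<and> reduced n v \<and>
     \<not> (u \<noteq> [] \<and> v \<noteq> [] \<and> snd (hd v) = opp (snd (last u)) \<and> idx n (snd (last u)) dvd fst (last u))"
proof (induction u)
  case (Cons l u)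
  then show ?case
    by (cases l; cases u; cases v) (auto simp: reduced_Cons)
qed simp

lemma reduced_replicate:
  assumes "reduced n (s @ s)"
  shows "reduced n (concat (replicate k s))"
proof (cases "s = []")
  case False
  show ?thesis
  proof (induction k)
    case (Suc k)
    have "hd (concat (replicate k s)) = hd s" if "concat (replicate k s) \<noteq> []"
      using that False by (cases k) auto
    then show ?case
      using Suc assms False by (auto simp: reduced_append)
  qed simp
qed simp

context lollipop
begin

lemma evs_append: "evs (u @ v) = evs v \<otimes> evs u"
  by (induction u rule: evs.induct) (auto simp: m_assoc)

lemma evs_replicate: "evs (concat (replicate k s)) = evs s [^] k"
  by (induction k) (auto simp: evs_append)

text \<open>
  Cyclic reduction. If the first and the last letter of a reduced word cancel against each other,
  conjugation makes the word shorter by two letters; a single letter that cancels against itself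
  is \<open>a\<close>, and then the element is conjugate to a power of \<open>a\<close>.
\<close>

lemma conjugacy_cases:
  assumes "g \<in> carrier G"
  shows "\<exists>c \<in> carrier G. (\<exists>j::int. conjugate c g = b [^] j) \<or> (\<exists>j::int. conjugate c g = a [^] j) \<or>
           (\<exists>s. s \<noteq> [] \<and> reduced n (s @ s) \<and> conjugate c g = evs s)"
    (is "\<exists>c \<in> carrier G. ?P c g")
  using assms
proof (induction "len g" arbitrary: g rule: less_induct)
  case less
  define s where "s = fst (nf g)"
  obtain m where m: "g = evs s \<otimes> b [^] (m::int)" using decompose less s_def by blast
  have len: "len g = length s" by (simp add: len_def s_def)
  have red: "reduced n s" using nf_normal_form less by (simp add: normal_form_def s_def)
  show ?case
  proof (cases "s = []")
    case True
    then have "conjugate \<one> g = b [^] m" using m by simp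
    then show ?thesis by blast
  next
    case False
    then obtain u r1 x1 where s: "s = u @ [(r1, x1)]"
      by (metis append_butlast_last_id surj_pair)
    define s' where "s' = u @ [(r1 + m, x1)]"
    have red': "reduced n s'"
      using red by (auto simp: s s'_def reduced_append)
    define g' where "g' = conjugate (b [^] m) g"
    have "g' = b [^] m \<otimes> evs s"
      using less(2) by (simp add: g'_def m conjugate_def m_assoc flip: int_pow_neg)
         (simp add: b_pow_add)
    then have g': "g' = evs s'"
      by (simp add: s s'_def evs_append m_assoc[symmetric] b_pow_add add.commute)
    have unconj: ?thesis if "d \<in> carrier G" "?P d g'" for d
    proof
      show "d \<otimes> b [^] m \<in> carrier G" using that by simp
      have "conjugate d g' = conjugate (d \<otimes> b [^] m) g"
        unfolding g'_def using that less by (simp add: conjugate_conjugate)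
      then show "?P (d \<otimes> b [^] m) g" using that by simp
    qed
    show ?thesis
    proof (cases "reduced n (s' @ s')")
      case True
      have "s' \<noteq> [] \<and> reduced n (s' @ s') \<and> conjugate \<one> g' = evs s'"
        using True g' by (simp add: s'_def)
      then show ?thesis using unconj by blast
    next
      case nred: False
      then have hd: "snd (hd s') = opp x1" and dvd: "idx n x1 dvd r1 + m"
      proof -
        have "last s' = (r1 + m, x1)" by (simp add: s'_def)
        then show "snd (hd s') = opp x1" "idx n x1 dvd r1 + m"
          using nred red' by (auto simp: reduced_append[of n s' s'])
      qed
      show ?thesis
      proof (cases u)
        case Nil
        then have x1: "x1 = Flip" using hd by (cases x1) (auto simp: s'_def)
        obtain i where i: "r1 + m = 2 ^ n * i" using dvd x1 by (auto simp: dvd_def)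
        have "a [^] (2 * i + 1) = (a [^] (2::int)) [^] i \<otimes> a"
          by (simp add: int_pow_pow int_pow_mult)
        also have "\<dots> = b [^] (r1 + m) \<otimes> a"
          by (simp add: rel_a int_pow_pow i)
        finally have "conjugate \<one> g' = a [^] (2 * i + 1)"
          using Nil x1 g' by (simp add: s'_def)
        then show ?thesis using unconj by blast
      next
        case (Cons l mid)
        then obtain r where u: "u = (r, opp x1) # mid"
          using hd by (cases l) (auto simp: s'_def)
        define e where "e = b [^] (r1 + m) \<otimes> el x1"
        have e: "e \<in> carrier G" by (simp add: e_def)
        define d where "d = inv e"
        have d: "d \<in> carrier G" using e by (simp add: d_def)
        obtain j where j: "r1 + m = j * idx n x1" using dvd by (auto simp: dvd_def)
        have turn: "el (opp x1) \<otimes> e = b [^] (turn n x1 + j * idx n (opp x1))"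
        proof -
          have "el (opp x1) \<otimes> e = el (opp x1) \<otimes> (el x1 \<otimes> b [^] (j * idx n (opp x1)))"
            by (simp add: e_def j b_idx_el)
          then show ?thesis by (simp add: m_assoc[symmetric] el_opp' b_pow_add)
        qed
        have "g' = e \<otimes> evs mid \<otimes> b [^] r \<otimes> el (opp x1)"
          by (simp add: g' s'_def u evs_append e_def)
        then have "conjugate d g' = evs mid \<otimes> b [^] r \<otimes> (el (opp x1) \<otimes> e)"
          using e by (simp add: conjugate_def d_def m_assoc inv_solve_left')
        also have "\<dots> = evs mid \<otimes> b [^] r \<otimes> b [^] (turn n x1 + j * idx n (opp x1))"
          unfolding turn ..
        finally have eq: "conjugate d g' = evs mid \<otimes> b [^] r \<otimes> b [^] (turn n x1 + j * idx n (opp x1))" .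
        have "len (conjugate d g') < len g"
          unfolding eq using len_evs[of mid] by (simp add: len s u)
        moreover have gc: "g' \<in> carrier G" by (simp add: g')
        ultimately obtain c where c: "c \<in> carrier G" "?P c (conjugate d g')"
          using less(1)[of "conjugate d g'"] d by auto
        have "conjugate c (conjugate d g') = conjugate (c \<otimes> d) g'"
          using c d gc by (simp add: conjugate_conjugate)
        then show ?thesis using c d unconj[of "c \<otimes> d"] by simp
      qed
    qed
  qed
qed

text \<open>
  The elements that fix a vertex of the Bass--Serre tree.
\<close>

definition elliptic :: "'a \<Rightarrow> bool" where
  "elliptic g \<longleftrightarrow> (\<exists>c \<in> carrier G. \<exists>j::int. g = conjugate c (b [^] j) \<or> g = conjugate c (a [^] j))"

lemma a_pow_double: "a [^] (2 * i :: int) = b [^] (2 ^ n * i)"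
  by (metis gens_closed(1,2) int_pow_pow rel_a)

lemma len_a_pow: "len (a [^] (j::int)) \<le> 1"
proof (cases "even j")
  case True
  then show ?thesis by (auto simp: a_pow_double elim!: evenE)
next
  case False
  then obtain i where "j = 2 * i + 1" by (auto elim: oddE)
  then have "a [^] j = b [^] (2 ^ n * i) \<otimes> el Flip"
    by (simp add: int_pow_mult a_pow_double)
  then show ?thesis using len_mult_el[of "b [^] (2 ^ n * i)" Flip] by auto
qed

lemma elliptic_bounded:
  assumes "elliptic g"
  shows "\<exists>B. \<forall>k::int. len (g [^] k) \<le> B"
proof -
  obtain c and j :: int where c: "c \<in> carrier G"
    and g: "g = conjugate c (b [^] j) \<or> g = conjugate c (a [^] j)"
    using assms unfolding elliptic_def by blast
  have "len (g [^] k) \<le> 2 * len c + 1" for k :: int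
    using g
  proof
    assume "g = conjugate c (b [^] j)"
    then show ?thesis
      using c len_conjugate[of c "b [^] (j * k)"] by (simp add: conjugate_int_pow int_pow_pow)
  next
    assume "g = conjugate c (a [^] j)"
    then show ?thesis
      using c len_conjugate[of c "a [^] (j * k)"] len_a_pow[of "j * k"]
      by (simp add: conjugate_int_pow int_pow_pow)
  qed
  then show ?thesis by blast
qed

text \<open>
  \<open>L\<close> is the translation length of \<open>g\<close> on the tree of cosets of \<open>\<langle>b\<rangle>\<close>, because powers of a
  cyclically reduced word are reduced.
\<close>

lemma non_elliptic_growth:
  assumes "g \<in> carrier G" "\<not> elliptic g"
  obtains c L where "c \<in> carrier G" "L > 0" "\<And>k::nat. len (conjugate c g [^] k) = k * L"
proof -
  obtain c where c: "c \<in> carrier G" and P: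
    "(\<exists>j::int. conjugate c g = b [^] j) \<or> (\<exists>j::int. conjugate c g = a [^] j) \<or>
           (\<exists>s. s \<noteq> [] \<and> reduced n (s @ s) \<and> conjugate c g = evs s)"
    using conjugacy_cases[OF assms(1)] by (elim bexE)
  have unconj: "g = conjugate (inv c) h" if "conjugate c g = h" for h
    using that conjugate_eq_iff(2)[of c g h] assms c by auto
  have "conjugate c g \<noteq> b [^] j" "conjugate c g \<noteq> a [^] j" for j :: int
    using unconj inv_closed[OF c] assms(2) unfolding elliptic_def by blast+
  then obtain s where s: "s \<noteq> []" "reduced n (s @ s)" "conjugate c g = evs s"
    using P by blast
  have "len (conjugate c g [^] k) = k * length s" for k :: nat
    using len_reduced[OF reduced_replicate[OF s(2), of k]]
    by (simp add: s(3) evs_replicate length_concat sum_list_replicate)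
  with that[of c "length s"] c s(1) show ?thesis by simp
qed

lemma elliptic_if_pow_elliptic:
  assumes "g \<in> carrier G" "elliptic (g [^] (2::int))"
  shows "elliptic g"
proof (rule ccontr)
  assume "\<not> elliptic g"
  then obtain c L where c: "c \<in> carrier G" and L: "L > 0"
    and len: "\<And>k::nat. len (conjugate c g [^] k) = k * L"
    using non_elliptic_growth assms(1) by blast
  obtain B where B: "\<And>k::int. len ((g [^] (2::int)) [^] k) \<le> B"
    using elliptic_bounded assms(2) by blast
  have "2 * k * L \<le> 2 * len c + B" for k :: nat
  proof -
    have "conjugate c g [^] (2 * k) = conjugate c ((g [^] (2::int)) [^] int k)"
      using c assms(1) conjugate_int_pow[of c g "2 * int k"]
      by (simp add: int_pow_pow flip: int_pow_int)
    then show ?thesis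
      using len[of "2 * k"] len_conjugate[of c "(g [^] (2::int)) [^] int k"] B[of "int k"] c assms(1)
      by (simp del: int_pow_pow)
  qed
  from this[of "2 * len c + B + 1"] show False
    using L by (cases L) auto
qed

text \<open>
  Translation length is a conjugacy invariant and multiplicative in powers, so \<open>9 L = 18 L\<close>. With
  lengths in place of translation lengths, this holds up to the constant \<open>2 * len d\<close>.
\<close>

lemma elliptic_if_self_conjugate:
  assumes "g \<in> carrier G" "h \<in> carrier G" "conjugate h (g [^] (9::int)) = g [^] (18::int)"
  shows "elliptic g"
proof (rule ccontr)
  assume "\<not> elliptic g"
  then obtain c L where c: "c \<in> carrier G" and L: "L > 0"
    and len: "\<And>k::nat. len (conjugate c g [^] k) = k * L"
    using non_elliptic_growth assms(1) by blast
  define d where "d = c \<otimes> h \<otimes> inv c"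
  have d: "d \<in> carrier G" using c assms by (simp add: d_def)
  \<comment> \<open>The element \<open>d\<close> does for \<open>conjugate c g\<close> what \<open>h\<close> does for \<open>g\<close>.\<close>
  have "18 * k * L \<le> 2 * len d + 9 * k * L" for k :: nat
  proof -
    have "g [^] (18 * int k) = conjugate h (g [^] (9 * int k))"
      using assms by (metis conjugate_int_pow int_pow_closed int_pow_pow)
    then have "conjugate c (g [^] (18 * int k)) = conjugate (c \<otimes> h) (g [^] (9 * int k))"
      using assms c by (simp add: conjugate_conjugate)
    also have "\<dots> = conjugate d (conjugate c (g [^] (9 * int k)))"
      using assms c by (simp add: conjugate_conjugate d_def m_assoc)
    finally have "conjugate c g [^] (18 * k) = conjugate d (conjugate c g [^] (9 * k))"
      using assms c by (simp add: conjugate_int_pow flip: int_pow_int)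
    then have "len (conjugate c g [^] (18 * k)) \<le> 2 * len d + len (conjugate c g [^] (9 * k))"
      using len_conjugate[OF d] c assms(1) by simp
    then show ?thesis by (simp only: len)
  qed
  \<comment> \<open>The growth rates \<open>18\<close> and \<open>9\<close> differ, so any exponent above \<open>2 * len d\<close> is a contradiction.\<close>
  from this[of "2 * len d + 1"] have "9 * ((2 * len d + 1) * L) \<le> 2 * len d"
    by (simp only: mult.assoc)
  moreover have "1 * ((2 * len d + 1) * 1) \<le> 9 * ((2 * len d + 1) * L)"
    using L by (intro mult_le_mono) auto
  ultimately have "1 * ((2 * len d + 1) * 1) \<le> 2 * len d" by (rule le_trans[rotated])
  then show False by simp
qed

text \<open>
  Conjugation of \<open>b\<^sup>p\<close> by a reduced word stays inside \<open>\<langle>b\<rangle>\<close> only if \<open>b\<^sup>p\<close> can pass each letter in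
  turn. Passing \<open>a\<close> does not change the exponent; passing \<open>t\<close> or its inverse requires the exponent
  to be divisible by \<open>9\<close> or \<open>18\<close> and leaves it divisible by \<open>9\<close>.
\<close>

lemma conjugate_b_pow_eq_b_pow:
  assumes "h \<in> carrier G" "conjugate h (b [^] (p::int)) = b [^] (q::int)"
  shows "p = q \<or> 9 dvd p \<and> 9 dvd q"
proof -
  have *: "p = q \<or> 9 dvd p \<and> 9 dvd q"
    if "reduced n s" "evs s \<otimes> b [^] p = b [^] q \<otimes> evs s" for s and p :: int
    using that
  proof (induction s arbitrary: p rule: evs.induct)
    case 1
    then have "nf (\<one> \<otimes> b [^] p) = nf (\<one> \<otimes> b [^] q)" by simp
    then show ?case by (simp only: nf_mult_b_pow one_closed) (simp add: nf_one shift_def)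
  next
    case (2 r x s)
    define k where "k = evs s \<otimes> b [^] r"
    have k: "k \<in> carrier G" "len k = length s"
      using 2(2) by (auto simp: k_def reduced_Cons len_reduced)
    have eq: "k \<otimes> el x \<otimes> b [^] p = b [^] q \<otimes> (k \<otimes> el x)"
      using 2(3) by (simp add: k_def)
    \<comment> \<open>Otherwise multiplying by \<open>opp x\<close> lengthens one side of \<open>eq\<close> and shortens the other.\<close>
    have "idx n (opp x) dvd p"
    proof (rule ccontr)
      assume "\<not> idx n (opp x) dvd p"
      then have "len (evs ((p, opp x) # (r, x) # s)) = length s + 2"
        using 2(2) by (subst len_reduced) auto
      moreover have "evs ((p, opp x) # (r, x) # s) = b [^] q \<otimes> (k \<otimes> b [^] turn n x)"
      proof -
        have "evs ((p, opp x) # (r, x) # s) = k \<otimes> el x \<otimes> b [^] p \<otimes> el (opp x)"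
          by (simp add: k_def)
        also have "\<dots> = b [^] q \<otimes> (k \<otimes> (el x \<otimes> el (opp x)))"
          unfolding eq using k by (simp add: m_assoc)
        finally show ?thesis by (simp add: el_opp)
      qed
      ultimately show False using k by simp
    qed
    then obtain j where j: "p = j * idx n (opp x)" by (auto simp: dvd_def)
    have "(k \<otimes> b [^] (j * idx n x)) \<otimes> el x = (b [^] q \<otimes> k) \<otimes> el x"
      using eq k by (simp add: m_assoc j flip: b_idx_el)
    then have "k \<otimes> b [^] (j * idx n x) = b [^] q \<otimes> k"
      using k by simp
    then have "(evs s \<otimes> b [^] (j * idx n x)) \<otimes> b [^] r = (b [^] q \<otimes> evs s) \<otimes> b [^] r"
      by (simp add: k_def b_pow_assoc add.commute) (simp add: m_assoc)
    then have "evs s \<otimes> b [^] (j * idx n x) = b [^] q \<otimes> evs s"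
      by simp
    then have "j * idx n x = q \<or> 9 dvd j * idx n x \<and> 9 dvd q"
      using 2(1) 2(2) by (simp add: reduced_Cons)
    then show ?case
      by (cases x) (auto simp: j)
  qed
  obtain m where m: "h = evs (fst (nf h)) \<otimes> b [^] (m::int)" using decompose assms by blast
  have "conjugate (evs (fst (nf h))) (b [^] p) = b [^] q"
  proof -
    have "conjugate h (b [^] p) = conjugate (evs (fst (nf h))) (conjugate (b [^] m) (b [^] p))"
      by (subst m) (simp add: conjugate_conjugate)
    moreover have "conjugate (b [^] m) (b [^] p) = b [^] p"
      by (simp add: conjugate_def b_pow_add flip: int_pow_neg)
    ultimately show ?thesis using assms(2) by simp
  qed
  then show ?thesis
    using *[of "fst (nf h)" p] nf_normal_form[OF assms(1)] by (auto simp: conjugate_eq_iff normal_form_def)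
qed

end

section \<open>Generating triples that satisfy the next relations\<close>

lemma (in group) hom_conjugate:
  assumes "comm_group H" "\<psi> \<in> hom G H" "c \<in> carrier G" "g \<in> carrier G"
  shows "\<psi> (conjugate c g) = \<psi> g"
proof -
  interpret H: comm_group H by fact
  interpret p: group_hom G H \<psi>
    using assms by (simp add: group_hom_def group_hom_axioms_def is_group H.is_group)
  show ?thesis
    using assms by (simp add: conjugate_def H.m_comm[of "\<psi> c"] H.m_assoc)
qed

text \<open>
  If \<open>a\<close> and \<open>b\<close> vanish under \<open>(\<tau>, \<psi>)\<close>, then the image of \<open>G\<close> in \<open>\<int> \<times> H\<close> is generated by the image of \<open>t\<close>.
  A cyclic group that maps onto \<open>\<int>\<close> does so injectively.
\<close>

lemma (in group) cyclic_image:
  assumes gen: "carrier G = generate G {a, b, t}" and cl: "{a, b, t} \<subseteq> carrier G"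
    and H: "group H" and \<psi>: "\<psi> \<in> hom G H" and \<tau>: "\<tau> \<in> hom G integer_group"
    and a: "\<psi> a = \<one>\<^bsub>H\<^esub>" "\<tau> a = 0" and b: "\<psi> b = \<one>\<^bsub>H\<^esub>" "\<tau> b = 0"
    and c: "c \<in> carrier G" "\<tau> c = 0" and d: "d \<in> carrier G" "\<tau> d = 1"
  shows "\<psi> c = \<one>\<^bsub>H\<^esub>"
proof -
  interpret p: group_hom G H \<psi>
    using assms by (simp add: group_hom_def group_hom_axioms_def is_group)
  interpret q: group_hom G integer_group \<tau>
    using assms by (simp add: group_hom_def group_hom_axioms_def is_group)
  have pt: "\<psi> t \<in> carrier H" using cl by simp
  have *: "\<exists>j::int. \<tau> g = j * \<tau> t \<and> \<psi> g = \<psi> t [^]\<^bsub>H\<^esub> j" if "g \<in> generate G {a, b, t}" for g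
    using that cl
  proof (induction rule: generate_right_induct)
    case one
    show ?case by (rule exI[of _ 0]) simp
  next
    case (mult g x)
    then obtain j :: int where j: "\<tau> g = j * \<tau> t" "\<psi> g = \<psi> t [^]\<^bsub>H\<^esub> j" by blast
    from mult(2) consider "x = a \<or> x = b" | "x = t" by blast
    then show ?case
    proof cases
      case 1
      then show ?thesis using j mult cl a b pt by (intro exI[of _ j]) auto
    next
      case 2
      then show ?thesis using j mult cl pt
        by (intro exI[of _ "j + 1"]) (auto simp: p.H.int_pow_mult distrib_right)
    qed
  next
    case (inv g x)
    then obtain j :: int where j: "\<tau> g = j * \<tau> t" "\<psi> g = \<psi> t [^]\<^bsub>H\<^esub> j" by blast
    from inv(2) consider "x = a \<or> x = b" | "x = t" by blast
    then show ?case
    proof cases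
      case 1
      then show ?thesis using j inv cl a b pt by (intro exI[of _ j]) auto
    next
      case 2
      then show ?thesis using j inv cl pt
        by (intro exI[of _ "j - 1"]) (auto simp: p.H.int_pow_diff left_diff_distrib)
    qed
  qed
  obtain j :: int where j: "\<tau> c = j * \<tau> t" "\<psi> c = \<psi> t [^]\<^bsub>H\<^esub> j"
    using * c(1) gen by blast
  obtain i :: int where i: "\<tau> d = i * \<tau> t" using * d(1) gen by blast
  have "j = 0" using c(2) d(2) i j(1) by auto
  then show ?thesis using j(2) by simp
qed

context lollipop
begin

text \<open>
  The three characters \<open>\<tau>\<close>, \<open>\<chi>\<close> and \<open>\<psi>\<close> take values in \<open>\<int>\<close>, \<open>\<int>/2\<close> and \<open>\<int>/3\<close>. In the first two, \<open>b'\<close> vanishes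
  because its ninth and eighteenth powers are conjugate.
\<close>

theorem no_generators_of_next_level:
  assumes \<tau>: "\<tau> \<in> hom G integer_group" "\<tau> a = 0" "\<tau> b = 0" "\<tau> t = 1"
    and \<chi>: "\<chi> \<in> hom G (integer_mod_group 2)" "\<chi> a = 1" "\<chi> b = 0"
    and \<psi>: "\<psi> \<in> hom G (integer_mod_group 3)" "\<psi> b = 1"
    and cl: "a' \<in> carrier G" "b' \<in> carrier G" "t' \<in> carrier G"
    and gen: "carrier G = generate G {a', b', t'}"
    and rel_a': "a' [^] (2::int) = b' [^] (2 ^ Suc n :: int)"
    and rel_t': "t' \<otimes> b' [^] (9::int) \<otimes> inv t' = b' [^] (18::int)"
  shows False
proof -
  let ?N = "2 ^ n :: int"
  interpret \<tau>: group_hom G integer_group \<tau>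
    using \<tau> by (simp add: group_hom_def group_hom_axioms_def is_group)
  interpret \<chi>: group_hom G "integer_mod_group 2" \<chi>
    using \<chi> by (simp add: group_hom_def group_hom_axioms_def is_group)
  interpret \<psi>: group_hom G "integer_mod_group 3" \<psi>
    using \<psi> by (simp add: group_hom_def group_hom_axioms_def is_group)
  have conj: "conjugate t' (b' [^] (9::int)) = b' [^] (18::int)"
    using rel_t' by (simp add: conjugate_def)
  have "\<tau> (b' [^] (9::int)) = \<tau> (b' [^] (18::int))"
    using conj hom_conjugate[OF abelian_integer_group \<tau>(1)] cl by (metis int_pow_closed)
  then have \<tau>b: "\<tau> b' = 0" using cl by (simp add: \<tau>.hom_int_pow)
  have "\<tau> (a' [^] (2::int)) = \<tau> (b' [^] (2 ^ Suc n :: int))" by (simp only: rel_a')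
  then have \<tau>a: "\<tau> a' = 0" using cl \<tau>b by (simp add: \<tau>.hom_int_pow)
  have \<chi>r: "\<chi> g \<in> {0..<2}" if "g \<in> carrier G" for g
    using \<chi>.hom_closed[OF that] by (simp add: carrier_integer_mod_group)
  have even_zero: "even z \<Longrightarrow> 0 \<le> z \<Longrightarrow> z < 2 \<Longrightarrow> z = 0" for z :: int
    by presburger
  have "\<chi> (b' [^] (9::int)) = \<chi> (b' [^] (18::int))"
    using conj hom_conjugate[OF abelian_integer_mod_group \<chi>(1)] cl by (metis int_pow_closed)
  then have \<chi>b: "\<chi> b' = 0"
    using cl \<chi>r[of b'] by (auto simp: \<chi>.hom_int_pow int_pow_integer_mod_group dest: even_zero)
  have ell_b: "elliptic b'"
    using elliptic_if_self_conjugate cl conj by blast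
  \<comment> \<open>An odd power of \<open>a\<close> is excluded by \<open>\<chi>\<close>, and an even one is a power of \<open>b\<close>.\<close>
  obtain c and y :: int where c: "c \<in> carrier G" and b': "b' = conjugate c (b [^] y)"
  proof -
    obtain c and j :: int where c: "c \<in> carrier G"
      and j: "b' = conjugate c (b [^] j) \<or> b' = conjugate c (a [^] j)"
      using ell_b unfolding elliptic_def by blast
    show thesis
    proof (cases "b' = conjugate c (b [^] j)")
      case False
      then have b': "b' = conjugate c (a [^] j)" using j by simp
      have "\<chi> b' = j mod 2"
        using b' c hom_conjugate[OF abelian_integer_mod_group \<chi>(1)]
        by (simp add: \<chi>.hom_int_pow int_pow_integer_mod_group \<chi>(2))
      then have "even j" using \<chi>b by presburger
      then obtain i where "j = 2 * i" by (auto elim: evenE)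
      then show ?thesis using that c b' by (simp add: a_pow_double)
    qed (use that c in blast)
  qed
  have "elliptic (a' [^] (2::int))"
    using c cl by (simp add: rel_a' b' conjugate_int_pow int_pow_pow) (auto simp: elliptic_def)
  then have ell_a: "elliptic a'" using elliptic_if_pow_elliptic cl by blast
  have \<chi>a: "\<chi> a' \<noteq> 0"
  proof
    assume "\<chi> a' = 0"
    then have "\<chi> a = \<one>\<^bsub>integer_mod_group 2\<^esub>"
      using cl \<tau>a \<tau>b \<chi>b \<tau> \<chi>
      by (intro cyclic_image[OF gen _ _ \<chi>(1) \<tau>(1), of a t]) auto
    then show False using \<chi>(2) by simp
  qed
  obtain d and x :: int where d: "d \<in> carrier G" and a': "a' = conjugate d (a [^] x)" and x: "odd x"
  proof -
    obtain d and j :: int where d: "d \<in> carrier G"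
      and j: "a' = conjugate d (b [^] j) \<or> a' = conjugate d (a [^] j)"
      using ell_a unfolding elliptic_def by blast
    have "a' \<noteq> conjugate d (b [^] j)"
      using \<chi>a d hom_conjugate[OF abelian_integer_mod_group \<chi>(1)]
      by (auto simp: \<chi>.hom_int_pow int_pow_integer_mod_group \<chi>(3))
    then have a': "a' = conjugate d (a [^] j)" using j by simp
    have "\<chi> a' = j mod 2"
      using a' d hom_conjugate[OF abelian_integer_mod_group \<chi>(1)]
      by (simp add: \<chi>.hom_int_pow int_pow_integer_mod_group \<chi>(2))
    then have "odd j" using \<chi>a by presburger
    then show thesis using that d a' by blast
  qed
  have "conjugate d (b [^] (?N * x)) = conjugate c (b [^] (y * 2 ^ Suc n))"
  proof -
    have "a' [^] (2::int) = conjugate d (a [^] (2 * x))"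
      using d by (simp add: a' conjugate_int_pow int_pow_pow mult.commute)
    then show ?thesis
      using rel_a' c by (simp add: a_pow_double b' conjugate_int_pow int_pow_pow)
  qed
  then have "conjugate (inv c) (conjugate d (b [^] (?N * x))) = b [^] (y * 2 ^ Suc n)"
    using c d by (simp add: conjugate_conjugate)
  then have "conjugate (inv c \<otimes> d) (b [^] (?N * x)) = b [^] (y * 2 ^ Suc n)"
    using c d by (simp add: conjugate_conjugate)
  then have "?N * x = y * 2 ^ Suc n \<or> 9 dvd ?N * x \<and> 9 dvd y * 2 ^ Suc n"
    using c d by (intro conjugate_b_pow_eq_b_pow[of "inv c \<otimes> d"]) auto
  then show False
  proof
    assume "?N * x = y * 2 ^ Suc n"
    then have "x = 2 * y" by simp
    then show False using x by simp
  next
    assume 9: "9 dvd ?N * x \<and> 9 dvd y * 2 ^ Suc n"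
    have "coprime (3::int) 2" using coprime_add_one_left[of "2::int"] by simp
    then have cop: "coprime (3::int) (2 ^ k)" for k :: nat
      by (simp only: coprime_power_right_iff simp_thms)
    have "3 dvd ?N * x" "3 dvd y * 2 ^ Suc n"
      using 9 dvd_trans[of 3 "9::int"] by simp_all
    then have 3: "3 dvd x" "3 dvd y"
      using coprime_dvd_mult_right_iff[OF cop[of n], of x]
        coprime_dvd_mult_left_iff[OF cop[of "Suc n"], of y] by blast+
    have "\<psi> a' = \<psi> (a [^] x)" "\<psi> b' = \<psi> (b [^] y)"
      using a' b' c d hom_conjugate[OF abelian_integer_mod_group \<psi>(1)] by auto
    then have "\<psi> a' = 0" "\<psi> b' = 0"
      using 3 by (auto simp: \<psi>.hom_int_pow int_pow_integer_mod_group)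
    then have "\<psi> b = \<one>\<^bsub>integer_mod_group 3\<^esub>"
      using cl \<tau>a \<tau>b \<tau>
      by (intro cyclic_image[OF gen _ _ \<psi>(1) \<tau>(1), of b t]) auto
    then show False using \<psi>(2) by simp
  qed
qed

end

section \<open>Recognising trees and GBS groups\<close>

lemma pcas_consecutive:
  assumes "pcas u p v" "i < length p"
  shows "fst (p ! i) = (if i = 0 then u else snd (p ! (i - 1)))" and "snd (last p) = v"
  using assms
proof (induction p arbitrary: u i)
  case (Cons e p)
  case 1
  then show ?case
    using Cons(1)[of "snd e" "i - 1"] by (cases i) (auto simp: nth_Cons')
next
  case (Cons e p)
  case 2
  then show ?case using Cons(2)[of "snd e" 0] by (cases p) auto
qed simp_all

lemma tl_pawalk_verts: "pcas u p v \<Longrightarrow> tl (pawalk_verts u p) = map snd p"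
proof -
  have "pcas u p v \<Longrightarrow> pawalk_verts u p = u # map snd p"
    by (induction p arbitrary: u) auto
  then show "pcas u p v \<Longrightarrow> tl (pawalk_verts u p) = map snd p" by simp
qed

text \<open>
  On a cycle with at least three edges, the two neighbours of a deepest vertex would both have
  smaller depth, so they would coincide.
\<close>

lemma simple_tree_if_depth:
  fixes T :: "'v pair_pre_digraph" and depth :: "'v \<Rightarrow> nat"
  assumes wf: "parcs T \<subseteq> pverts T \<times> pverts T"
    and sym: "sym (parcs T)"
    and root: "r \<in> pverts T" "\<And>v. v \<in> pverts T \<Longrightarrow> (r, v) \<in> (parcs T)\<^sup>*"
    and neq: "\<And>u v. (u, v) \<in> parcs T \<Longrightarrow> depth u \<noteq> depth v"
    and lower: "\<And>u v w. (u, v) \<in> parcs T \<Longrightarrow> (u, w) \<in> parcs T \<Longrightarrow>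
       depth v < depth u \<Longrightarrow> depth w < depth u \<Longrightarrow> v = w"
  shows "simple_tree T"
  unfolding simple_tree_def
proof (intro conjI)
  show "pair_bidirected_digraph T"
    using wf sym neq by unfold_locales (auto simp: symmetric_def dest: neq)
  have mk: "verts (mk_symmetric (with_proj T)) = pverts T"
    "arcs_ends (mk_symmetric (with_proj T)) = parcs T"
    using sym by (auto simp: mk_symmetric_def sym_def)
  have on: "(u, v) \<in> rtrancl_on (pverts T) (parcs T)" if "(u, v) \<in> (parcs T)\<^sup>*" "u \<in> pverts T" for u v
    using that(1)
  proof induction
    case (step y z)
    then show ?case using wf by (auto intro: rtrancl_on_into_rtrancl_on)
  qed (use that in auto)
  have "(u, v) \<in> (parcs T)\<^sup>*" if "u \<in> pverts T" "v \<in> pverts T" for u v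
    using root(2)[OF that(1)] root(2)[OF that(2)] sym_rtrancl[OF sym]
    by (meson rtrancl_trans symE)
  then show "connected (with_proj T)"
    unfolding connected_def strongly_connected_def reachable_def mk
    using root(1) on by blast
  show "\<not> (\<exists>p. pre_digraph.cycle (with_proj T) p \<and> 3 \<le> length p)"
  proof
    assume "\<exists>p. pre_digraph.cycle (with_proj T) p \<and> 3 \<le> length p"
    then obtain p u where p: "pcas u p u" "set p \<subseteq> parcs T" "distinct (tl (pawalk_verts u p))"
      and k3: "3 \<le> length p"
      by (auto simp: pre_digraph.cycle_def pre_digraph.awalk_def cas_with_proj_eq
          awalk_verts_with_proj_eq)
    define k where "k = length p"
    define V where "V i = snd (p ! i)" for i
    have dist: "distinct (map snd p)" using p(3) by (simp add: tl_pawalk_verts[OF p(1)])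
    have inj: "i = j" if "i < k" "j < k" "V i = V j" for i j
      using dist that by (auto simp: distinct_conv_nth k_def V_def)
    have arc: "(V (if i = 0 then k - 1 else i - 1), V i) \<in> parcs T" if "i < k" for i
    proof -
      have "fst (p ! i) = V (if i = 0 then k - 1 else i - 1)"
        using pcas_consecutive[OF p(1), of i] that k3 by (auto simp: V_def k_def last_conv_nth)
      moreover have "p ! i \<in> parcs T" using that p(2) by (auto simp: k_def)
      ultimately show ?thesis by (metis V_def prod.collapse)
    qed
    define D where "D = (\<lambda>i. depth (V i)) ` {..<k}"
    have "depth (V 0) \<in> D" unfolding D_def using k3 by (intro imageI) (auto simp: k_def)
    then have D: "finite D" "D \<noteq> {}" by (auto simp: D_def)
    have "\<exists>M \<in> D. \<forall>x \<in> D. x \<le> M"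
      using Max_in[OF D] Max_ge[OF D(1)] by (intro bexI[of _ "Max D"] ballI)
    then obtain M where M: "M \<in> D" "\<forall>x \<in> D. x \<le> M" by (elim bexE)
    obtain m where m1: "m < k" and mD: "M = depth (V m)"
      using M(1) unfolding D_def by (elim imageE) simp
    have m2: "depth (V i) \<le> depth (V m)" if "i < k" for i
      using bspec[OF M(2), of "depth (V i)"] that unfolding mD by (simp add: D_def)
    note m = m1 m2
    \<comment> \<open>The predecessor and the successor of the deepest vertex in cyclic order.\<close>
    define i where "i = (if m = 0 then k - 1 else m - 1)"
    define j where "j = (if m = k - 1 then 0 else m + 1)"
    have ij: "i < k" "j < k" "i \<noteq> j" using m(1) k3 by (auto simp: i_def j_def k_def)
    have "(V i, V m) \<in> parcs T" using arc[OF m(1)] by (simp add: i_def)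
    then have a: "(V m, V i) \<in> parcs T" using sym by (auto dest: symD)
    have b: "(V m, V j) \<in> parcs T"
      using arc[OF ij(2)] m(1) by (auto simp: j_def split: if_splits)
    have "depth (V i) < depth (V m)" "depth (V j) < depth (V m)"
      using neq[OF a] neq[OF b] m(2)[OF ij(1)] m(2)[OF ij(2)] by auto
    then have "V i = V j" using lower a b by blast
    then show False using inj ij by blast
  qed
qed

context group
begin

lemma infinite_cyclic_powers:
  assumes c: "c \<in> carrier G" and inf: "\<And>k::int. c [^] k = \<one> \<Longrightarrow> k = 0"
  shows "infinite_cyclic (G\<lparr>carrier := range (\<lambda>k::int. c [^] k)\<rparr>)"
proof -
  let ?H = "range (\<lambda>k::int. c [^] k)"
  have sub: "subgroup ?H G" using c by (rule subgroup_of_powers)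
  interpret H: group "G\<lparr>carrier := ?H\<rparr>"
    using sub is_group by (rule subgroup.subgroup_is_group)
  have cH: "c \<in> ?H" using c int_pow_1[of c] by (metis rangeI)
  have "cyclic_group (G\<lparr>carrier := ?H\<rparr>)"
    unfolding H.cyclic_group
  proof
    show "c \<in> carrier (G\<lparr>carrier := ?H\<rparr>)" using cH by simp
    show "carrier (G\<lparr>carrier := ?H\<rparr>) = range (\<lambda>k::int. c [^]\<^bsub>G\<lparr>carrier := ?H\<rparr>\<^esub> k)"
      by (simp only: int_pow_consistent[OF sub cH, symmetric]) simp
  qed
  moreover have "inj (\<lambda>k::int. c [^] k)"
  proof (rule injI)
    fix i j :: int assume "c [^] i = c [^] j"
    then have "c [^] (i - j) = \<one>" using c by (simp add: int_pow_diff)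
    then show "i = j" using inf by fastforce
  qed
  then have "infinite ?H" using range_inj_infinite finite_imageD infinite_UNIV_int by blast
  ultimately show ?thesis by (simp add: infinite_cyclic_def)
qed

text \<open>
  The vertices are transported to the natural numbers here, once and for all, so that the
  tree itself can be built from cosets.
\<close>

lemma GBS_groupI:
  fixes V :: "'v set" and \<mu> :: "'a \<Rightarrow> 'v \<Rightarrow> 'v" and depth :: "'v \<Rightarrow> nat"
  assumes fg: "finitely_generated G"
    and count: "countable V"
    and act_closed: "\<And>g v. g \<in> carrier G \<Longrightarrow> v \<in> V \<Longrightarrow> \<mu> g v \<in> V"
    and act_one: "\<And>v. v \<in> V \<Longrightarrow> \<mu> \<one> v = v"
    and act_mult: "\<And>g h v. g \<in> carrier G \<Longrightarrow> h \<in> carrier G \<Longrightarrow> v \<in> V \<Longrightarrow>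
       \<mu> (g \<otimes> h) v = \<mu> g (\<mu> h v)"
    and E: "E \<subseteq> V \<times> V" "sym E"
    and root: "r \<in> V" "\<And>v. v \<in> V \<Longrightarrow> (r, v) \<in> E\<^sup>*"
    and neq: "\<And>u v. (u, v) \<in> E \<Longrightarrow> depth u \<noteq> depth v"
    and lower: "\<And>u v w. (u, v) \<in> E \<Longrightarrow> (u, w) \<in> E \<Longrightarrow>
       depth v < depth u \<Longrightarrow> depth w < depth u \<Longrightarrow> v = w"
    and act_E: "\<And>g u v. g \<in> carrier G \<Longrightarrow> (u, v) \<in> E \<Longrightarrow> (\<mu> g u, \<mu> g v) \<in> E"
    and no_inv: "\<And>g u v. g \<in> carrier G \<Longrightarrow> (u, v) \<in> E \<Longrightarrow> \<mu> g u = v \<Longrightarrow> \<mu> g v \<noteq> u"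
    and stab_V: "\<And>v. v \<in> V \<Longrightarrow> infinite_cyclic (G\<lparr>carrier := {g \<in> carrier G. \<mu> g v = v}\<rparr>)"
    and stab_E: "\<And>u v. (u, v) \<in> E \<Longrightarrow>
       infinite_cyclic (G\<lparr>carrier := {g \<in> carrier G. \<mu> g u = u \<and> \<mu> g v = v}\<rparr>)"
  shows "GBS_group G"
proof -
  define e where "e = to_nat_on V"
  have inj: "inj_on e V" using count by (simp add: e_def inj_on_to_nat_on)
  define d where "d = inv_into V e"
  have d: "d (e v) = v" if "v \<in> V" for v using that inj by (simp add: d_def)
  define T where "T = \<lparr>pverts = e ` V, parcs = map_prod e e ` E\<rparr>"
  define \<phi> where "\<phi> g = (\<lambda>m \<in> e ` V. e (\<mu> g (d m)))" for g
  have \<phi>: "\<phi> g (e v) = e (\<mu> g v)" if "v \<in> V" for g v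
    using that by (simp add: \<phi>_def d)
  have e_eq: "e u = e v \<longleftrightarrow> u = v" if "u \<in> V" "v \<in> V" for u v
    using inj that by (meson inj_on_eq_iff)
  have EV: "u \<in> V" "v \<in> V" if "(u, v) \<in> E" for u v using that E by auto
  have tree: "simple_tree T"
  proof (rule simple_tree_if_depth[of T "e r" "depth \<circ> d"])
    show "parcs T \<subseteq> pverts T \<times> pverts T" using E by (auto simp: T_def)
    show "sym (parcs T)" using E(2) by (auto simp: T_def sym_def)
    show "e r \<in> pverts T" using root by (simp add: T_def)
    have "(e r, e v) \<in> (map_prod e e ` E)\<^sup>*" if "(r, v) \<in> E\<^sup>*" for v
      using that by induction (auto intro: rtrancl_into_rtrancl)
    then show "(e r, v) \<in> (parcs T)\<^sup>*" if "v \<in> pverts T" for v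
      using that root by (auto simp: T_def)
    show "(depth \<circ> d) u \<noteq> (depth \<circ> d) v" if "(u, v) \<in> parcs T" for u v
      using that neq EV by (auto simp: T_def d)
    show "v = w" if uv: "(u, v) \<in> parcs T" and uw: "(u, w) \<in> parcs T"
      and lt: "(depth \<circ> d) v < (depth \<circ> d) u" "(depth \<circ> d) w < (depth \<circ> d) u" for u v w
    proof -
      obtain u1 v1 where 1: "(u1, v1) \<in> E" "u = e u1" "v = e v1" using uv by (auto simp: T_def)
      obtain u2 w2 where 2: "(u2, w2) \<in> E" "u = e u2" "w = e w2" using uw by (auto simp: T_def)
      have "u1 = u2" using 1 2 EV e_eq by metis
      then show ?thesis using 1 2 lt lower[of u1 v1 w2] EV d by auto
    qed
  qed
  have bij: "\<phi> g \<in> Bij (e ` V)" if g: "g \<in> carrier G" for g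
  proof -
    have "bij_betw (\<phi> g) (e ` V) (e ` V)"
    proof (rule bij_betw_byWitness[where f' = "\<phi> (inv g)"])
      show "\<forall>m\<in>e ` V. \<phi> (inv g) (\<phi> g m) = m" "\<forall>m\<in>e ` V. \<phi> g (\<phi> (inv g) m) = m"
        using g by (auto simp: \<phi> act_closed act_one simp flip: act_mult)
    qed (use g in \<open>auto simp: \<phi> act_closed\<close>)
    then show ?thesis by (simp add: Bij_def \<phi>_def)
  qed
  have "\<phi> \<in> hom G (BijGroup (e ` V))"
  proof (rule homI)
    fix g h assume gh: "g \<in> carrier G" "h \<in> carrier G"
    show "\<phi> g \<in> carrier (BijGroup (e ` V))" using bij gh by (simp add: BijGroup_def)
    have "\<phi> (g \<otimes> h) = compose (e ` V) (\<phi> g) (\<phi> h)"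
    proof
      fix m
      show "\<phi> (g \<otimes> h) m = compose (e ` V) (\<phi> g) (\<phi> h) m"
      proof (cases "m \<in> e ` V")
        case True
        then obtain v where v: "v \<in> V" "m = e v" by auto
        then show ?thesis
          using gh True by (simp add: compose_eq \<phi> act_closed act_mult)
      qed (simp add: compose_def \<phi>_def)
    qed
    then show "\<phi> (g \<otimes> h) = \<phi> g \<otimes>\<^bsub>BijGroup (e ` V)\<^esub> \<phi> h"
      using bij gh by (simp add: BijGroup_def)
  qed
  then have action: "group_action G (pverts T) \<phi>"
    by (simp add: group_action_def group_hom_def group_hom_axioms_def is_group group_BijGroup T_def)
  have stab: "stabilizer G \<phi> (e v) = {g \<in> carrier G. \<mu> g v = v}" if "v \<in> V" for v
    using that by (auto simp: stabilizer_def \<phi> act_closed e_eq)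
  have "GBS_action G T \<phi>"
    unfolding GBS_action_def tree_action_def tree_action_axioms_def GBS_action_axioms_def
  proof (intro conjI allI impI)
    fix g u v assume g: "g \<in> carrier G" and "(u, v) \<in> parcs T"
    then obtain u1 v1 where 1: "(u1, v1) \<in> E" "u = e u1" "v = e v1" by (auto simp: T_def)
    show "(\<phi> g u, \<phi> g v) \<in> parcs T"
      using g 1 act_E[OF g 1(1)] EV[OF 1(1)] by (force simp: T_def \<phi>)
    show "\<not> (\<phi> g u = v \<and> \<phi> g v = u)"
      using no_inv[OF g 1(1)] EV[OF 1(1)] g by (auto simp: 1 \<phi> e_eq act_closed)
  next
    fix v assume "v \<in> pverts T"
    then obtain v1 where 1: "v1 \<in> V" "v = e v1" by (auto simp: T_def)
    then show "infinite_cyclic (G\<lparr>carrier := stabilizer G \<phi> v\<rparr>)"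
      using stab_V by (simp add: stab)
  next
    fix u v assume "(u, v) \<in> parcs T"
    then obtain u1 v1 where 1: "(u1, v1) \<in> E" "u = e u1" "v = e v1" by (auto simp: T_def)
    have "stabilizer G \<phi> u \<inter> stabilizer G \<phi> v = {g \<in> carrier G. \<mu> g u1 = u1 \<and> \<mu> g v1 = v1}"
      using 1 EV by (auto simp: stab)
    then show "infinite_cyclic (G\<lparr>carrier := stabilizer G \<phi> u \<inter> stabilizer G \<phi> v\<rparr>)"
      using stab_E[OF 1(1)] by simp
  qed (use action tree in auto)
  then show ?thesis using fg by (auto simp: GBS_group_def)
qed

end

section \<open>The Bass--Serre tree of a lollipop group\<close>

lemma (in group) l_coset_powers_eq_iff:
  assumes "c \<in> carrier G" "g \<in> carrier G" "h \<in> carrier G"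
  shows "g <# range (\<lambda>k::int. c [^] k) = h <# range (\<lambda>k::int. c [^] k)
     \<longleftrightarrow> (\<exists>k::int. h = g \<otimes> c [^] k)"
proof -
  let ?C = "range (\<lambda>k::int. c [^] k)"
  have sub: "subgroup ?C G" using assms by (simp add: subgroup_of_powers)
  have mem: "h \<in> g <# ?C \<longleftrightarrow> (\<exists>k::int. h = g \<otimes> c [^] k)" for g h
    by (auto simp: l_coset_def)
  have "h \<in> h <# ?C"
    unfolding mem using assms by (intro exI[of _ 0]) simp
  then show ?thesis
    using l_repr_independence[OF _ assms(2) sub] mem by metis
qed

context lollipop
begin

definition coset_a :: "'a \<Rightarrow> 'a set" where
  "coset_a g = g <# range (\<lambda>k::int. a [^] k)"

definition coset_b :: "'a \<Rightarrow> 'a set" where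
  "coset_b g = g <# range (\<lambda>k::int. b [^] k)"

text \<open>
  The letter \<open>a\<close> exchanges \<open>\<langle>b\<rangle>\<close> and \<open>a\<langle>b\<rangle>\<close>, which would be an inversion of an edge between them. The
  coset of \<open>\<langle>a\<rangle>\<close> is the midpoint of that edge, and taking it as a vertex removes the inversion.
\<close>

definition neighbour :: "'a \<Rightarrow> edge \<Rightarrow> 'a set" where
  "neighbour g x = (if x = Flip then coset_a g else coset_b (g \<otimes> el x))"

definition tree_verts :: "'a set set" where
  "tree_verts = coset_a ` carrier G \<union> coset_b ` carrier G"

definition tree_arcs :: "('a set \<times> 'a set) set" where
  "tree_arcs = {(coset_b g, neighbour g x) | g x. g \<in> carrier G} \<union>
     {(coset_a g, coset_b g) | g. g \<in> carrier G}"

text \<open>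
  The function \<open>len\<close> is constant on cosets of \<open>\<langle>b\<rangle>\<close> and takes two consecutive values on cosets of \<open>\<langle>a\<rangle>\<close>.
  The sum of minimum and maximum is an even number for the former; for the latter it is the odd
  number between the depths of the two neighbours.
\<close>

definition depth :: "'a set \<Rightarrow> nat" where
  "depth C = Min (len ` C) + Max (len ` C)"

lemma coset_a_eq_iff:
  "g \<in> carrier G \<Longrightarrow> h \<in> carrier G \<Longrightarrow>
     coset_a g = coset_a h \<longleftrightarrow> (\<exists>k::int. h = g \<otimes> a [^] k)"
  by (simp add: coset_a_def l_coset_powers_eq_iff)

lemma coset_b_eq_iff:
  "g \<in> carrier G \<Longrightarrow> h \<in> carrier G \<Longrightarrow>
     coset_b g = coset_b h \<longleftrightarrow> (\<exists>k::int. h = g \<otimes> b [^] k)"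
  by (simp add: coset_b_def l_coset_powers_eq_iff)

lemma coset_b_eq_iff_nf:
  assumes "g \<in> carrier G" "h \<in> carrier G"
  shows "coset_b g = coset_b h \<longleftrightarrow> fst (nf g) = fst (nf h)"
proof
  assume "fst (nf g) = fst (nf h)"
  then have "g = evs (fst (nf h)) \<otimes> b [^] snd (nf g)" "h = evs (fst (nf h)) \<otimes> b [^] snd (nf h)"
    using ev_nf assms by (metis ev_def)+
  then have "h = g \<otimes> b [^] (snd (nf h) - snd (nf g))"
    by (metis b_pow_assoc add_diff_cancel_left' add.commute diff_add_cancel evs_closed)
  then show "coset_b g = coset_b h" using assms coset_b_eq_iff by blast
qed (use assms in \<open>auto simp: coset_b_eq_iff nf_mult_b_pow\<close>)

lemma depth_coset_b:
  assumes "g \<in> carrier G"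
  shows "depth (coset_b g) = 2 * len g"
proof -
  have "coset_b g = range (\<lambda>k::int. g \<otimes> b [^] k)"
    by (auto simp: coset_b_def l_coset_def)
  then have "len ` coset_b g = {len g}"
    using assms by (simp add: image_image)
  then show ?thesis by (simp add: depth_def)
qed

lemma len_mult_a_pow:
  assumes "g \<in> carrier G"
  shows "len (g \<otimes> a [^] (k::int)) = (if even k then len g else len (g \<otimes> a))"
proof (cases "even k")
  case True
  then show ?thesis using assms by (auto simp: a_pow_double elim!: evenE)
next
  case False
  then obtain i where k: "k = 1 + 2 * i" by (metis oddE add.commute)
  have "g \<otimes> a [^] k = g \<otimes> a \<otimes> b [^] (2 ^ n * i)"
    using assms by (simp only: k int_pow_mult gens_closed a_pow_double) (simp add: m_assoc)
  then show ?thesis using assms False by simp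
qed

lemma depth_coset_a:
  assumes "g \<in> carrier G"
  shows "depth (coset_a g) = len g + len (g \<otimes> a)"
proof -
  have eq: "coset_a g = range (\<lambda>k::int. g \<otimes> a [^] k)"
    by (auto simp: coset_a_def l_coset_def)
  have "len g \<in> len ` coset_a g"
    unfolding eq image_image using assms by (intro range_eqI[of _ _ 0]) simp
  moreover have "len (g \<otimes> a) \<in> len ` coset_a g"
    unfolding eq image_image using assms by (intro range_eqI[of _ _ 1]) simp
  ultimately have "len ` coset_a g = {len g, len (g \<otimes> a)}"
    using assms by (auto simp: eq len_mult_a_pow)
  then show ?thesis by (simp add: depth_def)
qed

lemma coset_a_neq_coset_b:
  assumes "g \<in> carrier G" "h \<in> carrier G"
  shows "coset_a g \<noteq> coset_b h"
proof
  assume "coset_a g = coset_b h"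
  then have "len g + len (g \<otimes> a) = 2 * len h"
    using assms depth_coset_a depth_coset_b by metis
  moreover have "q = Suc p \<or> Suc q = p \<Longrightarrow> p + q \<noteq> 2 * r" for p q r :: nat
    by presburger
  ultimately show False using len_mult_el[OF assms(1), of Flip] by simp
qed

lemma depth_neighbour_less_iff:
  assumes "g \<in> carrier G"
  shows "depth (neighbour g x) < depth (coset_b g) \<longleftrightarrow> len (g \<otimes> el x) < len g"
  using assms by (auto simp: neighbour_def depth_coset_a depth_coset_b)

lemma depth_neighbour_neq:
  assumes "g \<in> carrier G"
  shows "depth (coset_b g) \<noteq> depth (neighbour g x)"
  using assms len_mult_el[OF assms, of x]
  by (cases "x = Flip") (auto simp: neighbour_def depth_coset_a depth_coset_b)

lemma neighbour_in_verts: "g \<in> carrier G \<Longrightarrow> neighbour g x \<in> tree_verts"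
  by (auto simp: neighbour_def tree_verts_def)

lemma coset_a_mult_a_pow: "g \<in> carrier G \<Longrightarrow> coset_a (g \<otimes> a [^] (k::int)) = coset_a g"
  using coset_a_eq_iff[of g "g \<otimes> a [^] k"] by auto

lemma coset_b_mult_b_pow: "g \<in> carrier G \<Longrightarrow> coset_b (g \<otimes> b [^] (k::int)) = coset_b g"
  by (simp add: coset_b_eq_iff_nf nf_mult_b_pow)

lemma neighbour_opp:
  assumes "g \<in> carrier G" "x \<noteq> Flip"
  shows "neighbour (g \<otimes> el x) (opp x) = coset_b g"
proof -
  have "opp x \<noteq> Flip" using assms by (cases x) auto
  moreover have "g \<otimes> el x \<otimes> el (opp x) = g \<otimes> b [^] turn n x"
    using assms by (simp add: m_assoc el_opp)
  ultimately show ?thesis using assms by (simp add: neighbour_def coset_b_mult_b_pow)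
qed

lemma sym_tree_arcs: "sym tree_arcs"
proof (rule symI)
  fix u v assume "(u, v) \<in> tree_arcs"
  then consider g x where "g \<in> carrier G" "u = coset_b g" "v = neighbour g x"
    | g where "g \<in> carrier G" "u = coset_a g" "v = coset_b g"
    by (auto simp: tree_arcs_def)
  then show "(v, u) \<in> tree_arcs"
  proof cases
    case 1
    show ?thesis
    proof (cases "x = Flip")
      case True
      then show ?thesis using 1 by (auto simp: tree_arcs_def neighbour_def)
    next
      case False
      then have "v = coset_b (g \<otimes> el x)" "u = neighbour (g \<otimes> el x) (opp x)"
        using 1 by (simp_all add: neighbour_opp) (simp add: neighbour_def)
      then show ?thesis using 1 by (auto simp: tree_arcs_def)
    qed
  next
    case 2
    then have "u = neighbour g Flip" by (simp add: neighbour_def)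
    then show ?thesis using 2 by (auto simp: tree_arcs_def)
  qed
qed

lemma pop_if_len_less:
  assumes "g \<in> carrier G" "len (g \<otimes> el x) < len g"
  shows "snd (hd (fst (nf g))) = opp x" and "fst (nf (g \<otimes> el x)) = tl (fst (nf g))"
    and "idx n x dvd snd (nf g)"
  using assms by (auto simp: len_def nf_mult_el step_def Let_def split: if_splits)

text \<open>
  The neighbour of \<open>g\<langle>b\<rangle>\<close> closer to the root belongs to the last letter of the normal form. For the
  letter \<open>a\<close> it is a coset of \<open>\<langle>a\<rangle>\<close>, which is determined because the representatives with a
  cancelling \<open>a\<close> differ by powers of \<open>b\<close> with exponents divisible by \<open>2^n\<close>, that is, by elements of \<open>\<langle>a\<rangle>\<close>.
\<close>

lemma lower_neighbour_unique:
  assumes g: "g \<in> carrier G" "h \<in> carrier G" "coset_b g = coset_b h"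
    and lt: "len (g \<otimes> el x) < len g" "len (h \<otimes> el y) < len h"
  shows "neighbour g x = neighbour h y"
proof -
  have eq: "fst (nf g) = fst (nf h)" using g coset_b_eq_iff_nf by simp
  then have "opp x = opp y"
    using pop_if_len_less(1)[OF g(1) lt(1)] pop_if_len_less(1)[OF g(2) lt(2)] by simp
  then have xy: "x = y" by (metis opp_opp)
  show ?thesis
  proof (cases "x = Flip")
    case True
    obtain i :: int where i: "h = g \<otimes> b [^] i" using g coset_b_eq_iff by blast
    have "2 ^ n dvd snd (nf g)" "2 ^ n dvd snd (nf h)"
      using pop_if_len_less(3)[OF g(1) lt(1)] pop_if_len_less(3)[OF g(2) lt(2)] True xy by auto
    moreover have "snd (nf h) = snd (nf g) + i"
      using g by (simp add: i nf_mult_b_pow shift_def)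
    ultimately have "2 ^ n dvd i" by (metis dvd_add_right_iff)
    then obtain j where "i = 2 ^ n * j" by (auto simp: dvd_def)
    then have "h = g \<otimes> a [^] (2 * j)" by (simp add: i a_pow_double)
    then have "coset_a g = coset_a h" using g coset_a_eq_iff by blast
    then show ?thesis using True xy by (simp add: neighbour_def)
  next
    case False
    have "fst (nf (g \<otimes> el x)) = fst (nf (h \<otimes> el x))"
      using pop_if_len_less(2)[OF g(1) lt(1)] pop_if_len_less(2)[OF g(2) lt(2)] xy eq by simp
    then show ?thesis using False xy g by (simp add: neighbour_def coset_b_eq_iff_nf)
  qed
qed

lemma tree_arcs_lower:
  assumes "(u, v) \<in> tree_arcs" "(u, w) \<in> tree_arcs" "depth v < depth u" "depth w < depth u"
  shows "v = w"
proof -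
  from assms(1) consider g x where "g \<in> carrier G" "u = coset_b g" "v = neighbour g x"
    | g where "g \<in> carrier G" "u = coset_a g" "v = coset_b g"
    by (auto simp: tree_arcs_def)
  then show ?thesis
  proof cases
    case 1
    obtain h y where h: "h \<in> carrier G" "u = coset_b h" "w = neighbour h y"
      using assms(2) 1 coset_a_neq_coset_b coset_a_neq_coset_b[THEN not_sym] by (auto simp: tree_arcs_def)
    have "len (g \<otimes> el x) < len g" "len (h \<otimes> el y) < len h"
      using assms(3,4) 1 h depth_neighbour_less_iff by metis+
    then show ?thesis using lower_neighbour_unique 1 h by metis
  next
    case 2
    obtain h where h: "h \<in> carrier G" "u = coset_a h" "w = coset_b h"
      using assms(2) 2 coset_a_neq_coset_b by (auto simp: tree_arcs_def)
    obtain k :: int where k: "h = g \<otimes> a [^] k" using 2 h coset_a_eq_iff by metis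
    have lg: "len g < len (g \<otimes> a)" using assms(3) 2 by (simp add: depth_coset_a depth_coset_b)
    have "depth u = len g + len (g \<otimes> a)" using 2 depth_coset_a by simp
    then have lh: "2 * len h < len g + len (g \<otimes> a)"
      using assms(4) h depth_coset_b by metis
    have "even k"
    proof (rule ccontr)
      assume "odd k"
      then have "len h = len (g \<otimes> a)" using 2 by (simp add: k len_mult_a_pow)
      then show False using lg lh by simp
    qed
    then obtain i where "k = 2 * i" by (auto elim: evenE)
    then have "h = g \<otimes> b [^] (2 ^ n * i)" by (simp add: k a_pow_double)
    then show ?thesis using 2 h coset_b_eq_iff by metis
  qed
qed

lemma tree_arcs_connected:
  assumes "v \<in> tree_verts"
  shows "(coset_b \<one>, v) \<in> tree_arcs\<^sup>*"
proof -
  have arc: "(coset_b g, neighbour g x) \<in> tree_arcs" if "g \<in> carrier G" for g x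
    using that by (auto simp: tree_arcs_def)
  have arc_a: "(coset_b g, coset_a g) \<in> tree_arcs" if "g \<in> carrier G" for g
    using arc[OF that, of Flip] by (simp add: neighbour_def)
  have step_a: "(coset_b g, coset_b h) \<in> tree_arcs\<^sup>*"
    if "g \<in> carrier G" "h \<in> carrier G" "coset_a g = coset_a h" for g h
  proof -
    have "(coset_a g, coset_b h) \<in> tree_arcs" using that by (auto simp: tree_arcs_def)
    then show ?thesis using arc_a[OF that(1)] by (meson r_into_rtrancl rtrancl_into_rtrancl)
  qed
  have reach: "(coset_b \<one>, coset_b g) \<in> tree_arcs\<^sup>*" if "g \<in> carrier G" for g
  proof -
    have "g \<in> generate G {a, b, t}" using that by (simp only: generated)
    moreover have "{a, b, t} \<subseteq> carrier G" by simp
    ultimately show ?thesis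
    proof (induction rule: generate_right_induct)
      case (mult g x)
      have A: "(coset_b g, coset_b (g \<otimes> a)) \<in> tree_arcs\<^sup>*"
        using mult coset_a_mult_a_pow[of g 1] by (intro step_a) auto
      have B: "coset_b (g \<otimes> b) = coset_b g"
        using coset_b_mult_b_pow[of g 1] mult by simp
      have T: "(coset_b g, coset_b (g \<otimes> t)) \<in> tree_arcs\<^sup>*"
        using arc[of g Up] mult by (auto simp: neighbour_def)
      show ?case using mult A B T by (auto intro: rtrancl_trans)
    next
      case (inv g x)
      have A: "(coset_b g, coset_b (g \<otimes> inv a)) \<in> tree_arcs\<^sup>*"
        using inv coset_a_mult_a_pow[of g "-1"] by (intro step_a) (auto simp: int_pow_neg)
      have B: "coset_b (g \<otimes> inv b) = coset_b g"
        using coset_b_mult_b_pow[of g "-1"] inv by (simp add: int_pow_neg)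
      have T: "(coset_b g, coset_b (g \<otimes> inv t)) \<in> tree_arcs\<^sup>*"
        using arc[of g Down] inv by (auto simp: neighbour_def)
      show ?case using inv A B T by (auto intro: rtrancl_trans)
    qed simp
  qed
  show ?thesis
    using assms reach arc_a by (auto simp: tree_verts_def intro: rtrancl_into_rtrancl)
qed

lemma l_coset_coset:
  assumes "g \<in> carrier G" "h \<in> carrier G"
  shows "g <# coset_a h = coset_a (g \<otimes> h)" and "g <# coset_b h = coset_b (g \<otimes> h)"
proof -
  have "range (\<lambda>k::int. a [^] k) \<subseteq> carrier G" "range (\<lambda>k::int. b [^] k) \<subseteq> carrier G" by auto
  then show "g <# coset_a h = coset_a (g \<otimes> h)" "g <# coset_b h = coset_b (g \<otimes> h)"
    using assms by (simp_all add: coset_a_def coset_b_def lcos_m_assoc)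
qed

lemma l_coset_neighbour:
  "g \<in> carrier G \<Longrightarrow> h \<in> carrier G \<Longrightarrow> g <# neighbour h x = neighbour (g \<otimes> h) x"
  by (simp add: neighbour_def l_coset_coset m_assoc)

lemma stabilizer_coset:
  assumes "g \<in> carrier G" "h \<in> carrier G"
  shows "h <# coset_a g = coset_a g \<longleftrightarrow> (\<exists>k::int. h = conjugate g (a [^] k))"
    and "h <# coset_b g = coset_b g \<longleftrightarrow> (\<exists>k::int. h = conjugate g (b [^] k))"
proof -
  have eq: "h \<otimes> g = g \<otimes> y \<longleftrightarrow> h = conjugate g y" if "y \<in> carrier G" for y
    using conjugate_eq_iff(1)[of g y h] assms that by metis
  show "h <# coset_a g = coset_a g \<longleftrightarrow> (\<exists>k::int. h = conjugate g (a [^] k))"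
    using assms eq coset_a_eq_iff[of g "h \<otimes> g"] by (auto simp: l_coset_coset)
  show "h <# coset_b g = coset_b g \<longleftrightarrow> (\<exists>k::int. h = conjugate g (b [^] k))"
    using assms eq coset_b_eq_iff[of g "h \<otimes> g"] by (auto simp: l_coset_coset)
qed

lemma mem_stabilizer_coset:
  assumes "g \<in> carrier G"
  shows "h \<in> carrier G \<and> h <# coset_a g = coset_a g \<longleftrightarrow> (\<exists>k::int. h = conjugate g (a [^] k))"
    and "h \<in> carrier G \<and> h <# coset_b g = coset_b g \<longleftrightarrow> (\<exists>k::int. h = conjugate g (b [^] k))"
proof -
  have "conjugate g (a [^] (k::int)) \<in> carrier G" "conjugate g (b [^] (k::int)) \<in> carrier G" for k
    using assms by simp_all
  then show "h \<in> carrier G \<and> h <# coset_a g = coset_a g \<longleftrightarrow> (\<exists>k::int. h = conjugate g (a [^] k))"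
    and "h \<in> carrier G \<and> h <# coset_b g = coset_b g \<longleftrightarrow> (\<exists>k::int. h = conjugate g (b [^] k))"
    using stabilizer_coset[OF assms] by metis+
qed

lemma b_pow_eq_one: "b [^] (k::int) = \<one> \<Longrightarrow> k = 0"
  using nf_mult_b_pow[of \<one> k] by (simp add: nf_one shift_def)

lemma a_pow_eq_one:
  assumes "a [^] (k::int) = \<one>"
  shows "k = 0"
proof -
  have "a [^] (2 * k) = \<one>" using assms int_pow_pow[of a k 2] by (simp add: mult.commute)
  then show ?thesis using b_pow_eq_one by (force simp: a_pow_double)
qed

lemma conjugate_eq_one:
  assumes "g \<in> carrier G" "y \<in> carrier G" "conjugate g y = \<one>"
  shows "y = \<one>"
  using assms conjugate_eq_iff(1)[of g y \<one>] by simp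

lemma infinite_cyclic_conjugates:
  assumes "g \<in> carrier G" "y \<in> carrier G" "\<And>k::int. y [^] k = \<one> \<Longrightarrow> k = 0"
    and "S = range (\<lambda>k::int. conjugate g (y [^] k))"
  shows "infinite_cyclic (G\<lparr>carrier := S\<rparr>)"
proof -
  have "S = range (\<lambda>k::int. conjugate g y [^] k)"
    using assms by (simp add: conjugate_int_pow)
  moreover have "k = 0" if "conjugate g y [^] k = \<one>" for k :: int
    using that assms by (metis conjugate_eq_one conjugate_int_pow int_pow_closed)
  ultimately show ?thesis using infinite_cyclic_powers[of "conjugate g y"] assms by simp
qed

text \<open>
  The intersection of \<open>\<langle>a\<rangle>\<close> and \<open>\<langle>b\<rangle>\<close> is generated by \<open>a\<^sup>2\<close>; it is the stabilizer of an edge between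
  their cosets.
\<close>

lemma a_pow_eq_b_pow:
  assumes "a [^] (i::int) = b [^] (j::int)"
  obtains k where "i = 2 * k" "j = 2 ^ n * k"
proof -
  have "even i"
  proof (rule ccontr)
    assume "odd i"
    then have "len (\<one> \<otimes> a [^] i) = len (\<one> \<otimes> el Flip)" by (simp only: len_mult_a_pow one_closed) simp
    then show False using assms len_mult_el[of \<one> Flip] by simp
  qed
  then obtain k where i: "i = 2 * k" by (auto elim: evenE)
  then have "b [^] (j - 2 ^ n * k) = \<one>"
    using assms by (simp add: a_pow_double int_pow_diff)
  then have "j = 2 ^ n * k" using b_pow_eq_one by fastforce
  then show thesis using that i by blast
qed

text \<open>
  This computes the stabilizer of an edge of the loop.
\<close>

lemma b_pow_eq_conjugate:
  assumes "x \<noteq> Flip"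
  shows "(\<exists>j::int. b [^] (i::int) = conjugate (el x) (b [^] j)) \<longleftrightarrow> idx n x dvd i"
proof
  assume "\<exists>j::int. b [^] i = conjugate (el x) (b [^] j)"
  then obtain j :: int where "conjugate (el x) (b [^] j) = b [^] i" by metis
  then have "el x \<otimes> b [^] j = b [^] i \<otimes> el x"
    by (simp add: conjugate_eq_iff)
  then have "fst (nf (\<one> \<otimes> el x \<otimes> b [^] j)) = fst (nf (\<one> \<otimes> b [^] i \<otimes> el x))" by simp
  then have "fst (step n x ([], 0)) = fst (step n x ([], i))"
    by (simp only: nf_mult_el nf_mult_b_pow one_closed m_closed el_closed int_pow_closed gens_closed)
      (simp add: nf_one shift_def)
  then show "idx n x dvd i" by (auto simp: step_def Let_def)
next
  assume "idx n x dvd i"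
  then obtain k where "i = k * idx n x" by (auto simp: dvd_def)
  then have "conjugate (el x) (b [^] (k * idx n (opp x))) = b [^] i"
    by (simp add: conjugate_eq_iff b_idx_el)
  then show "\<exists>j::int. b [^] i = conjugate (el x) (b [^] j)" by metis
qed

theorem GBS_group_lollipop:
  assumes "countable (carrier G)"
  shows "GBS_group G"
proof (rule GBS_groupI[where V = tree_verts and E = tree_arcs and \<mu> = "l_coset G"
      and r = "coset_b \<one>" and depth = depth])
  show "finitely_generated G"
    unfolding finitely_generated_def
    by (intro exI[of _ "{a, b, t}"]) (simp add: generated[symmetric])
  show "countable tree_verts" using assms by (simp add: tree_verts_def)
  show "sym tree_arcs" by (rule sym_tree_arcs)
  show "tree_arcs \<subseteq> tree_verts \<times> tree_verts"
    using neighbour_in_verts by (auto simp: tree_arcs_def tree_verts_def)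
  show "coset_b \<one> \<in> tree_verts" by (simp add: tree_verts_def)
  show "(coset_b \<one>, v) \<in> tree_arcs\<^sup>*" if "v \<in> tree_verts" for v
    using that by (rule tree_arcs_connected)
  show "v = w" if "(u, v) \<in> tree_arcs" "(u, w) \<in> tree_arcs" "depth v < depth u" "depth w < depth u" for u v w
    using that by (rule tree_arcs_lower)
  show "depth u \<noteq> depth v" if "(u, v) \<in> tree_arcs" for u v
  proof -
    have "depth (coset_a g) \<noteq> depth (coset_b g)" if "g \<in> carrier G" for g
      using depth_neighbour_neq[OF that, of Flip] by (simp add: neighbour_def)
    then show ?thesis using that depth_neighbour_neq by (auto simp: tree_arcs_def)
  qed
  fix g assume g: "g \<in> carrier G"
  show "g <# v \<in> tree_verts" if "v \<in> tree_verts" for v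
    using that g by (auto simp: tree_verts_def l_coset_coset)
  show "g \<otimes> h <# v = g <# (h <# v)" if "h \<in> carrier G" "v \<in> tree_verts" for h v
    using that g by (auto simp: tree_verts_def l_coset_coset m_assoc)
  show "(g <# u, g <# v) \<in> tree_arcs" if "(u, v) \<in> tree_arcs" for u v
  proof -
    have arcs: "(coset_b (g \<otimes> h), neighbour (g \<otimes> h) x) \<in> tree_arcs"
      "(coset_a (g \<otimes> h), coset_b (g \<otimes> h)) \<in> tree_arcs" if "h \<in> carrier G" for h x
      using that g m_closed[OF g that] unfolding tree_arcs_def by blast+
    from that consider h x where "h \<in> carrier G" "u = coset_b h" "v = neighbour h x"
      | h where "h \<in> carrier G" "u = coset_a h" "v = coset_b h"
      by (auto simp: tree_arcs_def)
    then show ?thesis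
      by cases (use g arcs in \<open>simp_all add: l_coset_coset l_coset_neighbour\<close>)
  qed
  show "g <# v \<noteq> u" if "(u, v) \<in> tree_arcs" "g <# u = v" for u v
  proof
    assume gv: "g <# v = u"
    from that(1) consider h x where "h \<in> carrier G" "u = coset_b h" "v = neighbour h x"
      | h where "h \<in> carrier G" "u = coset_a h" "v = coset_b h"
      by (auto simp: tree_arcs_def)
    then show False
    proof cases
      case 1
      show ?thesis
      proof (cases "x = Flip")
        case True
        then show ?thesis using 1 g that(2) coset_a_neq_coset_b[of h "g \<otimes> h"]
          by (simp add: neighbour_def l_coset_coset)
      next
        case False
        then have v: "v = coset_b (h \<otimes> el x)" using 1 by (simp add: neighbour_def)
        have "coset_b (h \<otimes> el x) = coset_b (g \<otimes> h)"
          using that(2) g 1(1,2) unfolding v by (simp add: l_coset_coset)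
        then obtain i :: int where i: "g \<otimes> h = h \<otimes> el x \<otimes> b [^] i"
          using coset_b_eq_iff[of "h \<otimes> el x" "g \<otimes> h"] g 1 by auto
        have "coset_b h = coset_b (g \<otimes> (h \<otimes> el x))"
          using gv g 1(1,2) unfolding v by (simp add: l_coset_coset)
        then obtain j :: int where j: "g \<otimes> (h \<otimes> el x) = h \<otimes> b [^] j"
          using coset_b_eq_iff[of h "g \<otimes> (h \<otimes> el x)"] g 1 by auto
        have "h \<otimes> (el x \<otimes> b [^] i \<otimes> el x) = h \<otimes> el x \<otimes> b [^] i \<otimes> el x"
          using 1 by (simp add: m_assoc)
        also have "\<dots> = g \<otimes> (h \<otimes> el x)"
          unfolding i[symmetric] using g 1 by (simp add: m_assoc)
        finally have "el x \<otimes> b [^] i \<otimes> el x = b [^] j" using 1 j by simp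
        then have "evs [(i, x), (0, x)] = b [^] j" by simp
        moreover have "len (evs [(i, x), (0, x)]) = 2"
          using False by (subst len_reduced) (cases x; simp)+
        ultimately show False by simp
      qed
    next
      case 2
      then show ?thesis using g that(2) coset_a_neq_coset_b[of "g \<otimes> h" h]
        by (simp add: l_coset_coset)
    qed
  qed
next
  show "\<one> <# v = v" if "v \<in> tree_verts" for v
    using that by (auto simp: tree_verts_def l_coset_coset)
  show "infinite_cyclic (G\<lparr>carrier := {g \<in> carrier G. g <# v = v}\<rparr>)" if "v \<in> tree_verts" for v
  proof -
    from that consider h where "h \<in> carrier G" "v = coset_a h" | h where "h \<in> carrier G" "v = coset_b h"
      by (auto simp: tree_verts_def)
    then show ?thesis
    proof cases
      case 1
      then show ?thesis using a_pow_eq_one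
        by (intro infinite_cyclic_conjugates[of h a] Set.set_eqI)
          (auto simp only: mem_Collect_eq mem_stabilizer_coset image_iff UNIV_I bex_simps gens_closed)
    next
      case 2
      then show ?thesis using b_pow_eq_one
        by (intro infinite_cyclic_conjugates[of h b] Set.set_eqI)
          (auto simp only: mem_Collect_eq mem_stabilizer_coset image_iff UNIV_I bex_simps gens_closed)
    qed
  qed
  show "infinite_cyclic (G\<lparr>carrier := {g \<in> carrier G. g <# u = u \<and> g <# v = v}\<rparr>)"
    if "(u, v) \<in> tree_arcs" for u v
  proof -
    have ab: "infinite_cyclic (G\<lparr>carrier :=
        {g \<in> carrier G. g <# coset_a h = coset_a h \<and> g <# coset_b h = coset_b h}\<rparr>)"
      if h: "h \<in> carrier G" for h
    proof (rule infinite_cyclic_conjugates[of h "a [^] (2::int)"])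
      show "k = 0" if "(a [^] (2::int)) [^] k = \<one>" for k :: int
        using that a_pow_eq_one[of "2 * k"] by (simp add: int_pow_pow)
      have "conjugate h x = conjugate h y \<longleftrightarrow> x = y" if "x \<in> carrier G" "y \<in> carrier G" for x y
        using that h by (simp add: conjugate_def)
      then have iff: "(\<exists>i::int. g = conjugate h (a [^] i)) \<and> (\<exists>j::int. g = conjugate h (b [^] j))
          \<longleftrightarrow> (\<exists>k::int. g = conjugate h (a [^] (2 * k)))" for g
        by (metis a_pow_eq_b_pow a_pow_double gens_closed(1,2) int_pow_closed)
      show "{g \<in> carrier G. g <# coset_a h = coset_a h \<and> g <# coset_b h = coset_b h}
          = range (\<lambda>k::int. conjugate h ((a [^] (2::int)) [^] k))"
      proof (rule Set.set_eqI)
        fix x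
        have "x \<in> {g \<in> carrier G. g <# coset_a h = coset_a h \<and> g <# coset_b h = coset_b h} \<longleftrightarrow>
          (x \<in> carrier G \<and> x <# coset_a h = coset_a h) \<and> (x \<in> carrier G \<and> x <# coset_b h = coset_b h)"
          by blast
        also have "\<dots> \<longleftrightarrow> (\<exists>k::int. x = conjugate h (a [^] (2 * k)))"
          unfolding mem_stabilizer_coset[OF h] by (rule iff)
        also have "\<dots> \<longleftrightarrow> x \<in> range (\<lambda>k::int. conjugate h ((a [^] (2::int)) [^] k))"
          by (simp add: int_pow_pow image_iff)
        finally show "x \<in> {g \<in> carrier G. g <# coset_a h = coset_a h \<and> g <# coset_b h = coset_b h} \<longleftrightarrow>
          x \<in> range (\<lambda>k::int. conjugate h ((a [^] (2::int)) [^] k))" .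
      qed
    qed (use h in auto)
    from that consider h x where "h \<in> carrier G" "u = coset_b h" "v = neighbour h x" "x \<noteq> Flip"
      | h where "h \<in> carrier G" "u = coset_b h" "v = coset_a h"
      | h where "h \<in> carrier G" "u = coset_a h" "v = coset_b h"
      by (fastforce simp: tree_arcs_def neighbour_def split: if_splits)
    then show ?thesis
    proof cases
      case 1
      have v: "v = coset_b (h \<otimes> el x)" using 1 by (simp add: neighbour_def)
      show ?thesis
      proof (rule infinite_cyclic_conjugates[of h "b [^] idx n x"])
        show "k = 0" if "(b [^] idx n x) [^] k = \<one>" for k :: int
          using that b_pow_eq_one[of "idx n x * k"] by (simp add: int_pow_pow)
        have inj: "conjugate h x = conjugate h y \<longleftrightarrow> x = y"
          if "x \<in> carrier G" "y \<in> carrier G" for x y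
          using that 1 by (simp add: conjugate_def)
        have "conjugate (h \<otimes> el x) (b [^] j) = conjugate h (conjugate (el x) (b [^] j))" for j :: int
          using 1 by (simp add: conjugate_conjugate)
        then have "(\<exists>i::int. g = conjugate h (b [^] i)) \<and> (\<exists>j::int. g = conjugate (h \<otimes> el x) (b [^] j))
          \<longleftrightarrow> (\<exists>i::int. g = conjugate h (b [^] i) \<and> (\<exists>j::int. b [^] i = conjugate (el x) (b [^] j)))" for g
          using inj by (metis gens_closed(2) int_pow_closed conjugate_closed el_closed)
        also have "\<dots> g \<longleftrightarrow> (\<exists>k::int. g = conjugate h (b [^] (idx n x * k)))" for g
          using 1 by (auto simp: b_pow_eq_conjugate dvd_def)
        finally have iff: "(\<exists>i::int. g = conjugate h (b [^] i)) \<and>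
            (\<exists>j::int. g = conjugate (h \<otimes> el x) (b [^] j))
          \<longleftrightarrow> (\<exists>k::int. g = conjugate h (b [^] (idx n x * k)))" for g .
        have he: "h \<otimes> el x \<in> carrier G" using 1 by simp
        show "{g \<in> carrier G. g <# u = u \<and> g <# v = v}
          = range (\<lambda>k::int. conjugate h ((b [^] idx n x) [^] k))"
        proof (rule Set.set_eqI)
          fix y
          have "y \<in> {g \<in> carrier G. g <# u = u \<and> g <# v = v} \<longleftrightarrow>
            (y \<in> carrier G \<and> y <# coset_b h = coset_b h) \<and>
            (y \<in> carrier G \<and> y <# coset_b (h \<otimes> el x) = coset_b (h \<otimes> el x))"
            unfolding 1(2) v by blast
          also have "\<dots> \<longleftrightarrow> (\<exists>k::int. y = conjugate h (b [^] (idx n x * k)))"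
            unfolding mem_stabilizer_coset(2)[OF 1(1)] mem_stabilizer_coset(2)[OF he] by (rule iff)
          also have "\<dots> \<longleftrightarrow> y \<in> range (\<lambda>k::int. conjugate h ((b [^] idx n x) [^] k))"
            by (simp add: int_pow_pow image_iff)
          finally show "y \<in> {g \<in> carrier G. g <# u = u \<and> g <# v = v} \<longleftrightarrow>
            y \<in> range (\<lambda>k::int. conjugate h ((b [^] idx n x) [^] k))" .
        qed
      qed (use 1 in auto)
    next
      case 2
      then show ?thesis using ab[of h] by (simp add: conj_commute)
    next
      case 3
      then show ?thesis using ab[of h] by simp
    qed
  qed
qed

end

section \<open>The sequence of groups\<close>

datatype lollipop_gen = lp_a | lp_b | lp_t

instance lollipop_gen :: countable
  by countable_datatype

definition lollipop_rels :: "nat \<Rightarrow> (lollipop_gen gword \<times> lollipop_gen gword) set" where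
  "lollipop_rels n =
     {(gen_pow lp_a 2, gen_pow lp_b (2 ^ n)),
      (gen_pow lp_t 1 @ gen_pow lp_b 9 @ gen_pow lp_t (- 1), gen_pow lp_b 18)}"

definition lollipop_group :: "nat \<Rightarrow> lollipop_gen gword set monoid" where
  "lollipop_group n = presented_group (lollipop_rels n)"

definition lollipop_elem :: "nat \<Rightarrow> lollipop_gen \<Rightarrow> lollipop_gen gword set" where
  "lollipop_elem n = pres_gen (lollipop_rels n)"

lemma group_lollipop_group: "group (lollipop_group n)"
  by (simp add: lollipop_group_def group_presented_group)

lemma (in group) lollipop_group_hom:
  assumes "x \<in> carrier G" "y \<in> carrier G" "z \<in> carrier G"
    and "x [^] (2::int) = y [^] (2 ^ n :: int)"
    and "z \<otimes> y [^] (9::int) \<otimes> inv z = y [^] (18::int)"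
  obtains h where "h \<in> hom (lollipop_group n) G"
    and "h (lollipop_elem n lp_a) = x" and "h (lollipop_elem n lp_b) = y"
    and "h (lollipop_elem n lp_t) = z"
proof -
  define f where "f u = (case u of lp_a \<Rightarrow> x | lp_b \<Rightarrow> y | lp_t \<Rightarrow> z)" for u
  have f_eq: "f lp_a = x" "f lp_b = y" "f lp_t = z" by (simp_all add: f_def)
  have f: "f u \<in> carrier G" for u using assms by (cases u) (auto simp: f_eq)
  have rel: "word_value G f r = word_value G f s" if "(r, s) \<in> lollipop_rels n" for r s
  proof -
    have z: "z [^] (-1::int) = inv z" using assms by (simp add: int_pow_neg)
    show ?thesis
      using that assms
      by (auto simp: lollipop_rels_def word_value_append[OF f] word_value_gen_pow[OF f] f_eq z
          simp flip: m_assoc)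
  qed
  have "\<exists>h \<in> hom (presented_group (lollipop_rels n)) G. \<forall>u. h (pres_gen (lollipop_rels n) u) = f u"
    by (rule presented_group_hom[OF f]) (rule rel)
  then obtain h where "h \<in> hom (presented_group (lollipop_rels n)) G"
    and "\<forall>u. h (pres_gen (lollipop_rels n) u) = f u"
    by (elim bexE)
  then show thesis
    using f_eq by (intro that[of h]) (simp_all add: lollipop_group_def lollipop_elem_def)
qed

definition BS_rels :: "int \<Rightarrow> int \<Rightarrow> (bs_gen gword \<times> bs_gen gword) set" where
  "BS_rels k l =
     {(gen_pow gen_t 1 @ gen_pow gen_a k @ gen_pow gen_t (- 1), gen_pow gen_a l)}"

definition BS_elem :: "int \<Rightarrow> int \<Rightarrow> bs_gen \<Rightarrow> bs_gen gword set" where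
  "BS_elem k l = pres_gen (BS_rels k l)"

lemma BS_eq: "BS k l = presented_group (BS_rels k l)"
  by (simp add: BS_def BS_rels_def)

lemma BS_elem_closed: "BS_elem k l x \<in> carrier (BS k l)"
  by (simp add: BS_eq BS_elem_def pres_gen_closed)

lemma (in group) BS_hom:
  assumes "x \<in> carrier G" "z \<in> carrier G" "z \<otimes> x [^] k \<otimes> inv z = x [^] l"
  obtains h where "h \<in> hom (BS k l) G" and "h (BS_elem k l gen_a) = x"
    and "h (BS_elem k l gen_t) = z"
proof -
  define f where "f u = (case u of gen_a \<Rightarrow> x | gen_t \<Rightarrow> z)" for u
  have f_eq: "f gen_a = x" "f gen_t = z" by (simp_all add: f_def)
  have f: "f u \<in> carrier G" for u using assms by (cases u) (auto simp: f_eq)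
  have rel: "word_value G f r = word_value G f s" if "(r, s) \<in> BS_rels k l" for r s
  proof -
    have z: "z [^] (-1::int) = inv z" using assms by (simp add: int_pow_neg)
    show ?thesis
      using that assms
      by (auto simp: BS_rels_def word_value_append[OF f] word_value_gen_pow[OF f] f_eq z
          simp flip: m_assoc)
  qed
  have "\<exists>h \<in> hom (presented_group (BS_rels k l)) G. \<forall>u. h (pres_gen (BS_rels k l) u) = f u"
    by (rule presented_group_hom[OF f]) (rule rel)
  then obtain h where "h \<in> hom (presented_group (BS_rels k l)) G"
    and "\<forall>u. h (pres_gen (BS_rels k l) u) = f u"
    by (elim bexE)
  then show thesis
    using f_eq by (intro that[of h]) (simp_all add: BS_eq BS_elem_def)
qed

text \<open>
  For the inverse of \<open>a\<close> the definition uses \<open>a\<^sup>-\<^sup>1 = b\<^bsup>-2^n\<^esup> a\<close>.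
\<close>

fun letter_act :: "nat \<Rightarrow> lollipop_gen \<times> bool \<Rightarrow> state \<Rightarrow> state" where
  "letter_act n (lp_a, True) w = step n Flip w"
| "letter_act n (lp_a, False) w = step n Flip (shift (- (2 ^ n)) w)"
| "letter_act n (lp_b, True) w = shift 1 w"
| "letter_act n (lp_b, False) w = shift (- 1) w"
| "letter_act n (lp_t, True) w = step n Up w"
| "letter_act n (lp_t, False) w = step n Down w"

lemma fold_gen_pow_b: "fold (letter_act n) (gen_pow lp_b k) w = shift k w"
proof -
  have "fold (letter_act n) (replicate m (lp_b, s)) w = shift (if s then int m else - int m) w" for m s
    by (induction m arbitrary: w) (cases s; simp add: add.commute)+
  then show ?thesis by (simp add: gen_pow_def)
qed

lemma letter_act_pres_cong:
  assumes "(u, v) \<in> pres_cong (lollipop_rels n)" "normal_form n (fst w)"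
  shows "fold (letter_act n) u w = fold (letter_act n) v w"
proof (rule fold_pres_cong[where S = "{w. normal_form n (fst w)}"])
  have norm: "normal_form n (fst (letter_act n l w))" if "normal_form n (fst w)" for l w
    using that by (cases "(n, l, w)" rule: letter_act.cases) (auto intro: normal_form_step)
  then show "letter_act n l w \<in> {w. normal_form n (fst w)}" if "w \<in> {w. normal_form n (fst w)}" for l w
    using that by simp
  have flip2: "step n Flip (step n Flip w) = shift (2 ^ n) w" if "normal_form n (fst w)" for w
    using step_opp_step[OF that, of Flip] by simp
  have flip_shift: "step n Flip (shift (- (2 ^ n)) w) = shift (- (2 ^ n)) (step n Flip w)" for w
    using step_shift[of n Flip "-1" w] by simp
  show "letter_act n (x, \<not> s) (letter_act n (x, s) w) = w" if "w \<in> {w. normal_form n (fst w)}" for x s w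
    using that step_opp_step[of n w Up] step_opp_step[of n w Down]
    by (cases x; cases s) (auto simp: flip2 flip_shift)
  show "fold (letter_act n) r w = fold (letter_act n) r' w"
    if "(r, r') \<in> lollipop_rels n" "w \<in> {w. normal_form n (fst w)}" for r r' w
  proof -
    have "gen_pow lp_a 2 = [(lp_a, True), (lp_a, True)]"
      by (simp add: gen_pow_def numeral_2_eq_2)
    then have "fold (letter_act n) (gen_pow lp_a 2) w = shift (2 ^ n) w"
      using that by (simp add: flip2)
    moreover have "fold (letter_act n) (gen_pow lp_t 1 @ gen_pow lp_b 9 @ gen_pow lp_t (- 1)) w = shift 18 w"
    proof -
      have t: "gen_pow lp_t 1 = [(lp_t, True)]" "gen_pow lp_t (- 1) = [(lp_t, False)]"
        by (simp_all add: gen_pow_def)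
      have "step n Down (shift 9 (step n Up w)) = shift 18 (step n Down (step n Up w))"
        using step_shift[of n Down 1] by simp
      also have "step n Down (step n Up w) = w"
        using that step_opp_step[of n w Up] by simp
      finally show ?thesis unfolding t fold_append comp_def fold_gen_pow_b by simp
    qed
    ultimately show ?thesis using that by (auto simp: lollipop_rels_def fold_gen_pow_b)
  qed
qed (use assms in auto)

definition lollipop_nf :: "nat \<Rightarrow> lollipop_gen gword set \<Rightarrow> state" where
  "lollipop_nf n U = fold (letter_act n) (SOME u. u \<in> U) ([], 0)"

lemma lollipop_nf_class:
  "lollipop_nf n (pres_cong (lollipop_rels n) `` {w}) = fold (letter_act n) w ([], 0)"
proof -
  let ?C = "pres_cong (lollipop_rels n) `` {w}"
  have "w \<in> ?C" by (simp add: pres_cong.refl)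
  then have "(SOME u. u \<in> ?C) \<in> ?C" by (rule someI)
  then have "(w, SOME u. u \<in> ?C) \<in> pres_cong (lollipop_rels n)" by simp
  then show ?thesis
    unfolding lollipop_nf_def
    by (intro letter_act_pres_cong[symmetric]) (simp_all add: normal_form_def)
qed

lemma lollipop_lollipop_group:
  "lollipop (lollipop_group n) n (lollipop_elem n lp_a) (lollipop_elem n lp_b)
     (lollipop_elem n lp_t) (lollipop_nf n)"
proof -
  let ?R = "lollipop_rels n" and ?e = "lollipop_elem n"
  interpret L: group "lollipop_group n" by (rule group_lollipop_group)
  have cl: "?e x \<in> carrier (lollipop_group n)" for x
    by (simp add: lollipop_elem_def lollipop_group_def pres_gen_closed)
  have cl': "pres_gen ?R x \<in> carrier (presented_group ?R)" for x
    by (rule pres_gen_closed)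
  interpret P: group "presented_group ?R" by (rule group_presented_group)
  have rel: "word_value (presented_group ?R) (pres_gen ?R) r
      = word_value (presented_group ?R) (pres_gen ?R) s"
    if "(r, s) \<in> ?R" for r s using that by (rule presented_group_rel)
  have 1: "?e lp_a [^]\<^bsub>lollipop_group n\<^esub> (2::int) = ?e lp_b [^]\<^bsub>lollipop_group n\<^esub> (2 ^ n :: int)"
    using rel[of "gen_pow lp_a 2" "gen_pow lp_b (2 ^ n)"]
    unfolding P.word_value_gen_pow[OF cl'] lollipop_elem_def lollipop_group_def
    by (simp add: lollipop_rels_def)
  have "word_value (presented_group ?R) (pres_gen ?R) (gen_pow lp_t 1 @ gen_pow lp_b 9 @ gen_pow lp_t (- 1))
      = word_value (presented_group ?R) (pres_gen ?R) (gen_pow lp_b 18)"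
    by (rule rel) (simp add: lollipop_rels_def)
  then have 2: "?e lp_t \<otimes>\<^bsub>lollipop_group n\<^esub> ?e lp_b [^]\<^bsub>lollipop_group n\<^esub> (9::int)
      \<otimes>\<^bsub>lollipop_group n\<^esub> inv\<^bsub>lollipop_group n\<^esub> ?e lp_t = ?e lp_b [^]\<^bsub>lollipop_group n\<^esub> (18::int)"
    unfolding P.word_value_append[OF cl'] P.word_value_gen_pow[OF cl'] lollipop_elem_def lollipop_group_def
    using cl' by (simp add: P.int_pow_neg P.m_assoc)
  have gen: "carrier (lollipop_group n)
      = generate (lollipop_group n) {?e lp_a, ?e lp_b, ?e lp_t}"
  proof -
    have U: "UNIV = {lp_a, lp_b, lp_t}" using lollipop_gen.exhaust by auto
    have "range (pres_gen ?R) = {?e lp_a, ?e lp_b, ?e lp_t}"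
      unfolding U by (simp add: lollipop_elem_def)
    then show ?thesis
      using presented_group_generate[of ?R] by (simp add: lollipop_group_def)
  qed
  have rep: "\<exists>w. g = pres_cong ?R `` {w}" if "g \<in> carrier (lollipop_group n)" for g
    using that by (auto simp: lollipop_group_def presented_group_def quotient_def)
  have nf_mult: "lollipop_nf n (g \<otimes>\<^bsub>lollipop_group n\<^esub> ?e x) = letter_act n (x, True) (lollipop_nf n g)"
    if g: "g \<in> carrier (lollipop_group n)" for g x
  proof -
    obtain w where w: "g = pres_cong ?R `` {w}" using rep g by blast
    then show ?thesis
      by (simp add: lollipop_group_def lollipop_elem_def pres_gen_def presented_group_mult
          lollipop_nf_class)
  qed
  have norm: "normal_form n (fst (fold (letter_act n) w s))" if "normal_form n (fst s)" for w s
    using that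
  proof (induction w arbitrary: s)
    case (Cons l w)
    have "normal_form n (fst (letter_act n l s))"
      using Cons.prems by (cases "(n, l, s)" rule: letter_act.cases) (auto intro: normal_form_step)
    then show ?case using Cons by simp
  qed simp
  have one: "\<one>\<^bsub>lollipop_group n\<^esub> = pres_cong ?R `` {[]}"
    by (simp add: lollipop_group_def presented_group_def)
  have nf_norm: "normal_form n (fst (lollipop_nf n g))" if g: "g \<in> carrier (lollipop_group n)" for g
  proof -
    obtain w where "g = pres_cong ?R `` {w}" using g by (elim exE[OF rep])
    then show ?thesis
      using norm[of "([], 0)" w] by (simp add: lollipop_nf_class normal_form_def[of n "[]"])
  qed
  show ?thesis
    by unfold_locales (use cl gen 1 2 nf_mult nf_norm in \<open>simp_all add: one lollipop_nf_class\<close>)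
qed

text \<open>
  Transport of the structure to an isomorphic group; it is applied to the copy on the natural
  numbers.
\<close>

lemma (in lollipop) lollipop_iso:
  assumes "group K" "h \<in> iso G K"
  shows "lollipop K n (h a) (h b) (h t) (nf \<circ> inv_into (carrier G) h)"
proof -
  interpret K: group K by fact
  interpret h: group_hom G K h
    using assms by (simp add: group_hom_def group_hom_axioms_def iso_def is_group)
  have bij: "bij_betw h (carrier G) (carrier K)" using assms by (simp add: iso_def)
  define d where "d = inv_into (carrier G) h"
  have d: "d (h g) = g" if "g \<in> carrier G" for g
    using bij that by (simp add: d_def bij_betw_def)
  have rep: "\<exists>g \<in> carrier G. k = h g" if "k \<in> carrier K" for k
    using bij that by (auto simp: bij_betw_def)
  have dcl: "d k \<in> carrier G" if "k \<in> carrier K" for k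
    using bij_betwE[OF bij_betw_inv_into[OF bij]] that by (simp add: d_def)
  have mult: "d (k \<otimes>\<^bsub>K\<^esub> h x) = d k \<otimes> x" if k: "k \<in> carrier K" and x: "x \<in> carrier G" for k x
  proof -
    obtain g where "g \<in> carrier G" "k = h g" using rep[OF k] by (elim bexE)
    then show "d (k \<otimes>\<^bsub>K\<^esub> h x) = d k \<otimes> x"
      using k x d by (simp_all flip: h.hom_mult)
  qed
  have gen: "carrier K = generate K {h a, h b, h t}"
    using h.generate_img[of "{a, b, t}"] bij by (simp add: bij_betw_def flip: generated)
  have one: "d \<one>\<^bsub>K\<^esub> = \<one>" using d[of \<one>] by simp
  have r1: "h a [^]\<^bsub>K\<^esub> (2::int) = h b [^]\<^bsub>K\<^esub> (2 ^ n :: int)"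
    using rel_a by (metis gens_closed(1,2) h.hom_int_pow)
  have "h (t \<otimes> b [^] (9::int) \<otimes> inv t) = h (b [^] (18::int))" by (simp only: rel_t)
  then have r2: "h t \<otimes>\<^bsub>K\<^esub> h b [^]\<^bsub>K\<^esub> (9::int) \<otimes>\<^bsub>K\<^esub> inv\<^bsub>K\<^esub> h t = h b [^]\<^bsub>K\<^esub> (18::int)"
    by (simp add: h.hom_int_pow)
  show ?thesis
    by unfold_locales
      (rule gen | use r1 r2 one mult dcl nf_one nf_normal_form nf_mult_a nf_mult_b nf_mult_t
        in \<open>simp add: d_def[symmetric]\<close>)+
qed

lemma (in group) nat_copy:
  assumes "countable (carrier G)"
  obtains K :: "nat monoid" and h where "group K" "h \<in> iso G K"
proof -
  define e where "e = to_nat_on (carrier G)"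
  have inj: "inj_on e (carrier G)" using assms by (simp add: e_def inj_on_to_nat_on)
  define d where "d = inv_into (carrier G) e"
  have d: "d (e x) = x" if "x \<in> carrier G" for x using that inj by (simp add: d_def)
  define K where "K = \<lparr>carrier = e ` carrier G, monoid.mult = (\<lambda>x y. e (d x \<otimes> d y)), one = e \<one>\<rparr>"
  have iso: "e \<in> iso G K"
    using inj by (auto simp: iso_def hom_def K_def d bij_betw_def)
  have "group K"
  proof (rule groupI)
    fix x assume "x \<in> carrier K"
    then obtain g where "g \<in> carrier G" "x = e g" by (auto simp: K_def)
    then show "\<exists>y\<in>carrier K. y \<otimes>\<^bsub>K\<^esub> x = \<one>\<^bsub>K\<^esub>"
      by (intro bexI[of _ "e (inv g)"]) (auto simp: K_def d)
  qed (auto simp: K_def d m_assoc)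
  then show thesis using that iso by blast
qed

lemma iso_imp_epi: "h \<in> iso G H \<Longrightarrow> h \<in> epi G H"
  by (simp add: iso_iff_mon_epi)

context lollipop
begin

text \<open>
  By \<open>b_idx_el\<close>, conjugation by \<open>t\<^sup>-\<^sup>1\<close> turns \<open>b\<close> to the power \<open>9 \<cdot> 2^(j+1)\<close> into \<open>b\<close> to the power
  \<open>9 \<cdot> 2^j\<close>. This descends from a power of \<open>a\<^sup>2\<close> to \<open>b\<^sup>9\<close>, and \<open>9\<close> is coprime to \<open>2^n\<close>.
\<close>

lemma generated_by_a_t: "carrier G = generate G {a, t}"
proof -
  let ?H = "generate G {a, t}"
  have sub: "subgroup ?H G" by (rule generate_is_subgroup) simp
  have pow: "x [^] (k::int) \<in> ?H" if "x \<in> ?H" for x k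
    using subgroup_int_pow_closed[OF sub that] .
  have at: "a \<in> ?H" "t \<in> ?H" by (auto intro: generate.incl)
  have bN: "b [^] (2 ^ n :: int) \<in> ?H" using pow[OF at(1), of 2] by (simp add: rel_a)
  \<comment> \<open>Going down one power of \<open>2\<close> at a time, as long as the exponent is divisible by \<open>18\<close>.\<close>
  have descend: "b [^] (9 * 2 ^ j :: int) \<in> ?H \<Longrightarrow> b [^] (9::int) \<in> ?H" for j :: nat
  proof (induction j)
    case (Suc j)
    have "b [^] (2 ^ j * idx n Up) \<otimes> el Up = el Up \<otimes> b [^] (2 ^ j * idx n (opp Up))"
      by (rule b_idx_el)
    then have "t \<otimes> b [^] (9 * 2 ^ j :: int) = b [^] (9 * 2 ^ Suc j :: int) \<otimes> t"
      by (simp add: mult.commute)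
    then have "b [^] (9 * 2 ^ j :: int) = inv t \<otimes> (b [^] (9 * 2 ^ Suc j :: int) \<otimes> t)"
      by (simp add: inv_solve_left)
    moreover have "\<dots> \<in> ?H"
      using sub at Suc.prems by (simp add: subgroup.m_closed subgroup.m_inv_closed)
    ultimately show ?case using Suc.IH by simp
  qed simp
  have "b [^] (9 * 2 ^ n :: int) \<in> ?H"
    using pow[OF bN, of 9] by (simp add: int_pow_pow mult.commute)
  then have b9: "b [^] (9::int) \<in> ?H" by (rule descend)
  have "coprime (9::int) (2 ^ n)"
  proof -
    have "coprime (3::int) 2" using coprime_add_one_left[of "2::int"] by simp
    then have "coprime ((3::int) ^ 2) (2 ^ n)"
      by (simp only: coprime_power_left_iff coprime_power_right_iff simp_thms)
    then show ?thesis by simp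
  qed
  then obtain u v :: int where "u * 9 + v * 2 ^ n = 1"
    using bezout_int[of 9 "2 ^ n"] by (auto simp: coprime_iff_gcd_eq_1)
  then have "b = (b [^] (9::int)) [^] u \<otimes> (b [^] (2 ^ n :: int)) [^] v"
    by (simp add: int_pow_pow b_pow_add mult.commute)
  moreover have "\<dots> \<in> ?H"
    using pow[OF b9, of u] pow[OF bN, of v] sub by (simp add: subgroup.m_closed)
  ultimately have "b \<in> ?H" by simp
  then have "generate G {a, b, t} \<subseteq> ?H"
    using at sub by (intro generate_subgroup_incl) auto
  moreover have "?H \<subseteq> carrier G" by (rule generate_incl) simp
  ultimately show ?thesis by (simp only: generated[symmetric] subset_antisym)
qed

end

text \<open>
  The map \<open>a \<mapsto> a, b \<mapsto> b\<^sup>2, t \<mapsto> t\<close>: its image contains \<open>b\<close> because \<open>a\<close> and \<open>t\<close> generate the target.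
\<close>

lemma next_level_epi: "\<exists>f. f \<in> epi (lollipop_group n) (lollipop_group (Suc n))"
proof -
  interpret L: lollipop "lollipop_group (Suc n)" "Suc n" "lollipop_elem (Suc n) lp_a"
    "lollipop_elem (Suc n) lp_b" "lollipop_elem (Suc n) lp_t" "lollipop_nf (Suc n)"
    by (rule lollipop_lollipop_group)
  interpret P: lollipop "lollipop_group n" n "lollipop_elem n lp_a"
    "lollipop_elem n lp_b" "lollipop_elem n lp_t" "lollipop_nf n"
    by (rule lollipop_lollipop_group)
  let ?a = "lollipop_elem (Suc n) lp_a" and ?b = "lollipop_elem (Suc n) lp_b"
    and ?t = "lollipop_elem (Suc n) lp_t" and ?L = "lollipop_group (Suc n)"
  have r1: "?a [^]\<^bsub>?L\<^esub> (2::int) = (?b [^]\<^bsub>?L\<^esub> (2::int)) [^]\<^bsub>?L\<^esub> (2 ^ n :: int)"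
    by (simp add: L.rel_a L.int_pow_pow)
  have "L.conjugate ?t (?b [^]\<^bsub>?L\<^esub> (9::int)) = ?b [^]\<^bsub>?L\<^esub> (18::int)"
    by (simp only: L.conjugate_def L.rel_t)
  then have "L.conjugate ?t ((?b [^]\<^bsub>?L\<^esub> (9::int)) [^]\<^bsub>?L\<^esub> (2::int))
      = (?b [^]\<^bsub>?L\<^esub> (18::int)) [^]\<^bsub>?L\<^esub> (2::int)"
    by (simp flip: L.conjugate_int_pow del: L.int_pow_pow)
  then have r2: "?t \<otimes>\<^bsub>?L\<^esub> (?b [^]\<^bsub>?L\<^esub> (2::int)) [^]\<^bsub>?L\<^esub> (9::int) \<otimes>\<^bsub>?L\<^esub> inv\<^bsub>?L\<^esub> ?t
      = (?b [^]\<^bsub>?L\<^esub> (2::int)) [^]\<^bsub>?L\<^esub> (18::int)"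
    by (simp add: L.conjugate_def L.int_pow_pow)
  obtain h where h: "h \<in> hom (lollipop_group n) ?L" "h (lollipop_elem n lp_a) = ?a"
    "h (lollipop_elem n lp_b) = ?b [^]\<^bsub>?L\<^esub> (2::int)" "h (lollipop_elem n lp_t) = ?t"
    by (rule L.lollipop_group_hom[OF L.gens_closed(1) L.int_pow_closed[OF L.gens_closed(2)]
          L.gens_closed(3) r1 r2])
  have "{?a, ?t} \<subseteq> h ` carrier (lollipop_group n)"
    using imageI[OF P.gens_closed(1), of h] imageI[OF P.gens_closed(3), of h] h by simp
  then show ?thesis
    using epi_if_generators_in_image[OF P.is_group L.is_group h(1) L.generated_by_a_t] by blast
qed

lemma quotient_of_BS_18_36: "\<exists>f. f \<in> epi (BS 18 36) (lollipop_group n)"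
proof -
  interpret L: lollipop "lollipop_group n" n "lollipop_elem n lp_a"
    "lollipop_elem n lp_b" "lollipop_elem n lp_t" "lollipop_nf n"
    by (rule lollipop_lollipop_group)
  let ?a = "lollipop_elem n lp_a" and ?b = "lollipop_elem n lp_b"
    and ?t = "lollipop_elem n lp_t" and ?L = "lollipop_group n"
  have "L.conjugate ?t (?b [^]\<^bsub>?L\<^esub> (9::int)) = ?b [^]\<^bsub>?L\<^esub> (18::int)"
    by (simp only: L.conjugate_def L.rel_t)
  then have "L.conjugate ?t ((?b [^]\<^bsub>?L\<^esub> (9::int)) [^]\<^bsub>?L\<^esub> (2 ^ n :: int))
      = (?b [^]\<^bsub>?L\<^esub> (18::int)) [^]\<^bsub>?L\<^esub> (2 ^ n :: int)"
    by (simp flip: L.conjugate_int_pow del: L.int_pow_pow)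
  moreover have "?a [^]\<^bsub>?L\<^esub> (18::int) = (?b [^]\<^bsub>?L\<^esub> (9::int)) [^]\<^bsub>?L\<^esub> (2 ^ n :: int)"
    "?a [^]\<^bsub>?L\<^esub> (36::int) = (?b [^]\<^bsub>?L\<^esub> (18::int)) [^]\<^bsub>?L\<^esub> (2 ^ n :: int)"
    using L.a_pow_double[of 9] L.a_pow_double[of 18] by (simp_all add: L.int_pow_pow mult.commute)
  ultimately have r: "?t \<otimes>\<^bsub>?L\<^esub> ?a [^]\<^bsub>?L\<^esub> (18::int) \<otimes>\<^bsub>?L\<^esub> inv\<^bsub>?L\<^esub> ?t = ?a [^]\<^bsub>?L\<^esub> (36::int)"
    by (simp only: L.conjugate_def)
  obtain h where h: "h \<in> hom (BS 18 36) ?L" "h (BS_elem 18 36 gen_a) = ?a"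
    "h (BS_elem 18 36 gen_t) = ?t"
    by (rule L.BS_hom[OF L.gens_closed(1,3) r])
  then have "{?a, ?t} \<subseteq> h ` carrier (BS 18 36)"
    using imageI[OF BS_elem_closed[of 18 36], of h] by (metis empty_subsetI insert_subset)
  then show ?thesis
    using epi_if_generators_in_image[OF group_BS L.is_group h(1) L.generated_by_a_t] by blast
qed

lemma epi_onto_BS_9_18:
  assumes "n \<ge> 1"
  shows "\<exists>f. f \<in> epi (lollipop_group n) (BS 9 18)"
proof -
  let ?B = "BS 9 18"
  interpret B: group ?B by (rule group_BS)
  interpret P: group "presented_group (BS_rels 9 18)" by (rule group_presented_group)
  let ?a = "BS_elem 9 18 gen_a" and ?t = "BS_elem 9 18 gen_t"
  have cl: "pres_gen (BS_rels 9 18) x \<in> carrier (presented_group (BS_rels 9 18))" for x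
    by (rule pres_gen_closed)
  have "word_value (presented_group (BS_rels 9 18)) (pres_gen (BS_rels 9 18))
        (gen_pow gen_t 1 @ gen_pow gen_a 9 @ gen_pow gen_t (- 1))
      = word_value (presented_group (BS_rels 9 18)) (pres_gen (BS_rels 9 18)) (gen_pow gen_a 18)"
    by (rule presented_group_rel) (simp add: BS_rels_def)
  then have r: "?t \<otimes>\<^bsub>?B\<^esub> ?a [^]\<^bsub>?B\<^esub> (9::int) \<otimes>\<^bsub>?B\<^esub> inv\<^bsub>?B\<^esub> ?t = ?a [^]\<^bsub>?B\<^esub> (18::int)"
    unfolding P.word_value_append[OF cl] P.word_value_gen_pow[OF cl] BS_elem_def BS_eq
    using cl by (simp add: P.int_pow_neg P.m_assoc)
  have r1: "(?a [^]\<^bsub>?B\<^esub> (2 ^ (n - 1) :: int)) [^]\<^bsub>?B\<^esub> (2::int) = ?a [^]\<^bsub>?B\<^esub> (2 ^ n :: int)"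
    using assms by (cases n) (simp_all add: B.int_pow_pow mult.commute BS_elem_closed)
  obtain h where h: "h \<in> hom (lollipop_group n) ?B"
    "h (lollipop_elem n lp_a) = ?a [^]\<^bsub>?B\<^esub> (2 ^ (n - 1) :: int)"
    "h (lollipop_elem n lp_b) = ?a" "h (lollipop_elem n lp_t) = ?t"
    by (rule B.lollipop_group_hom[OF B.int_pow_closed[OF BS_elem_closed] BS_elem_closed
          BS_elem_closed r1 r])
  have "lollipop_elem n x \<in> carrier (lollipop_group n)" for x
    by (simp add: lollipop_elem_def lollipop_group_def pres_gen_closed)
  then have "{?a, ?t} \<subseteq> h ` carrier (lollipop_group n)"
    using h(3,4) by (metis empty_subsetI imageI insert_subset)
  moreover have U: "UNIV = {gen_a, gen_t}" using bs_gen.exhaust by auto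
  have "range (pres_gen (BS_rels 9 18)) = {?a, ?t}"
    unfolding U by (simp add: BS_elem_def)
  then have "carrier ?B = generate ?B {?a, ?t}"
    using presented_group_generate[of "BS_rels 9 18"] by (simp add: BS_eq)
  ultimately show ?thesis
    using epi_if_generators_in_image[OF group_lollipop_group group_BS h(1)] by blast
qed

text \<open>
  The characters \<open>\<tau>\<close>, \<open>\<chi>\<close>, \<open>\<psi>\<close> are read off from the presentation. Modulo \<open>3\<close> the equation
  \<open>2 \<psi>(a) = 2^n\<close> for \<open>\<psi>(b) = 1\<close> is solved by \<open>\<psi>(a) = 2 \<cdot> 2^n\<close>, because \<open>4 = 1\<close>.
\<close>

lemma no_epi_backwards: "\<not> (\<exists>h. h \<in> epi (lollipop_group (Suc n)) (lollipop_group n))"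
proof
  assume "\<exists>h. h \<in> epi (lollipop_group (Suc n)) (lollipop_group n)"
  then obtain h where h: "h \<in> epi (lollipop_group (Suc n)) (lollipop_group n)" by blast
  interpret L: lollipop "lollipop_group n" n "lollipop_elem n lp_a"
    "lollipop_elem n lp_b" "lollipop_elem n lp_t" "lollipop_nf n"
    by (rule lollipop_lollipop_group)
  interpret M: lollipop "lollipop_group (Suc n)" "Suc n" "lollipop_elem (Suc n) lp_a"
    "lollipop_elem (Suc n) lp_b" "lollipop_elem (Suc n) lp_t" "lollipop_nf (Suc n)"
    by (rule lollipop_lollipop_group)
  let ?a = "lollipop_elem (Suc n) lp_a" and ?b = "lollipop_elem (Suc n) lp_b"
    and ?t = "lollipop_elem (Suc n) lp_t" and ?L = "lollipop_group n"
  interpret h: group_hom "lollipop_group (Suc n)" ?L h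
    using h by (simp add: group_hom_def group_hom_axioms_def epi_def L.is_group M.is_group)
  have gen: "carrier ?L = generate ?L {h ?a, h ?b, h ?t}"
    using h h.generate_img[of "{?a, ?b, ?t}"] by (simp add: epi_def flip: M.generated)
  have r1: "h ?a [^]\<^bsub>?L\<^esub> (2::int) = h ?b [^]\<^bsub>?L\<^esub> (2 ^ Suc n :: int)"
    using M.rel_a M.gens_closed by (metis h.hom_int_pow)
  have "h (?t \<otimes>\<^bsub>lollipop_group (Suc n)\<^esub> ?b [^]\<^bsub>lollipop_group (Suc n)\<^esub> (9::int)
      \<otimes>\<^bsub>lollipop_group (Suc n)\<^esub> inv\<^bsub>lollipop_group (Suc n)\<^esub> ?t) = h (?b [^]\<^bsub>lollipop_group (Suc n)\<^esub> (18::int))"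
    by (simp only: M.rel_t)
  then have r2: "h ?t \<otimes>\<^bsub>?L\<^esub> h ?b [^]\<^bsub>?L\<^esub> (9::int) \<otimes>\<^bsub>?L\<^esub> inv\<^bsub>?L\<^esub> h ?t = h ?b [^]\<^bsub>?L\<^esub> (18::int)"
    by (simp add: h.hom_int_pow)
  obtain \<tau> where \<tau>: "\<tau> \<in> hom ?L integer_group" "\<tau> (lollipop_elem n lp_a) = 0"
    "\<tau> (lollipop_elem n lp_b) = 0" "\<tau> (lollipop_elem n lp_t) = 1"
    using group.lollipop_group_hom[OF group_integer_group, of 0 0 1 n] by auto
  obtain \<chi> where \<chi>: "\<chi> \<in> hom ?L (integer_mod_group 2)" "\<chi> (lollipop_elem n lp_a) = 1"
    "\<chi> (lollipop_elem n lp_b) = 0"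
    using group.lollipop_group_hom[OF group_integer_mod_group, of 1 2 0 0 n]
    by (auto simp: int_pow_integer_mod_group)
  have m3: "2 * (2 * z mod 3) mod 3 = z mod 3" for z :: int by presburger
  obtain \<psi> where \<psi>: "\<psi> \<in> hom ?L (integer_mod_group 3)" "\<psi> (lollipop_elem n lp_b) = 1"
    using group.lollipop_group_hom[OF group_integer_mod_group, of "2 * 2 ^ n mod 3" 3 1 0 n]
    by (auto simp: int_pow_integer_mod_group carrier_integer_mod_group m3)
  show False
    using L.no_generators_of_next_level[OF \<tau> \<chi> \<psi> _ _ _ gen r1 r2] by simp
qed

theorem proposition3p9:
  shows "\<exists>(G :: nat \<Rightarrow> nat monoid) (f :: nat \<Rightarrow> nat \<Rightarrow> nat).
    (\<forall>n\<ge>1. f n \<in> epi (G n) (G (n + 1))) \<and>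
    (\<forall>n\<ge>1. GBS_group (G n) \<and> is_quotient_of (G n) (BS 18 36) \<and>
       (\<exists>h. h \<in> epi (G n) (BS 9 18))) \<and>
    (\<forall>n\<ge>1. \<not> (\<exists>h. h \<in> epi (G (n + 1)) (G n)))"
proof -
  have count: "countable (carrier (lollipop_group n))" for n
  proof -
    have "carrier (lollipop_group n) = (\<lambda>w. pres_cong (lollipop_rels n) `` {w}) ` UNIV"
      by (auto simp: lollipop_group_def presented_group_def quotient_def)
    then show ?thesis by simp
  qed
  have "\<exists>(K :: nat monoid) h. group K \<and> h \<in> iso (lollipop_group n) K" for n
    using group.nat_copy[OF group_lollipop_group count[of n]] by blast
  then obtain K :: "nat \<Rightarrow> nat monoid" and e where
    K: "group (K n)" and e: "e n \<in> iso (lollipop_group n) (K n)" for n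
    by metis
  have epi: "e n \<in> epi (lollipop_group n) (K n)" for n
    using e by (rule iso_imp_epi)
  have "\<exists>d. d \<in> epi (K n) (lollipop_group n)" for n
    using group.iso_set_sym[OF group_lollipop_group e[of n]] iso_imp_epi by blast
  then obtain d where d: "d n \<in> epi (K n) (lollipop_group n)" for n by metis
  have "\<exists>f. f \<in> epi (K n) (K (n + 1))" for n
    using next_level_epi[of n] epi_compose[OF epi_compose[OF d[of n]] epi[of "Suc n"]] by auto
  then obtain f where f: "f n \<in> epi (K n) (K (n + 1))" for n by metis
  have GBS: "GBS_group (K n)" for n
  proof -
    have "lollipop (K n) n (e n (lollipop_elem n lp_a)) (e n (lollipop_elem n lp_b))
        (e n (lollipop_elem n lp_t)) (lollipop_nf n \<circ> inv_into (carrier (lollipop_group n)) (e n))"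
      using lollipop.lollipop_iso[OF lollipop_lollipop_group K e] .
    then show ?thesis by (rule lollipop.GBS_group_lollipop) simp
  qed
  have quot: "is_quotient_of (K n) (BS 18 36)" for n
    using quotient_of_BS_18_36[of n] epi_compose[OF _ epi[of n]]
      epi_imp_is_quotient_of[OF group_BS K[of n]] by blast
  have onto: "\<exists>h. h \<in> epi (K n) (BS 9 18)" if "n \<ge> 1" for n
    using epi_onto_BS_9_18[OF that] epi_compose[OF d[of n]] by blast
  have no: "\<not> (\<exists>h. h \<in> epi (K (n + 1)) (K n))" for n
  proof
    assume "\<exists>h. h \<in> epi (K (n + 1)) (K n)"
    then obtain h where h: "h \<in> epi (K (Suc n)) (K n)" by auto
    have "d n \<circ> (h \<circ> e (Suc n)) \<in> epi (lollipop_group (Suc n)) (lollipop_group n)"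
      by (rule epi_compose[OF epi_compose[OF epi h] d])
    then show False using no_epi_backwards by blast
  qed
  show ?thesis
    by (rule exI[of _ K], rule exI[of _ f]) (use f GBS quot onto no in simp)
qed

end
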